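(* Let $m=p+q$ with $p,q\ge1$, write $\mathbb R^m=\mathbb R^p\oplus\mathbb R^q$, $x=u+v$ with $u\in\mathbb R^p$, $v\in\mathbb R^q$, and let $n\in\mathbb N$. For all $k,i\in\mathbb N$ let $\{P_{k,l}(u):l=1,\dots,\dim\mathcal M_k(\mathbb R^p,\mathbb C_p)\}$ be an orthonormal basis of $\mathcal M_k(\mathbb R^p,\mathbb C_p)$ and $\{Q_{i,j}(v):j=1,\dots,\dim\mathcal M_i(\mathbb R^q,\mathbb C_q)\}$ an orthonormal basis of $\mathcal M_i(\mathbb R^q,\mathbb C_q)$. Then the polynomials $$P_M\big(u^sP_{k,l}(u)Q_{i,j}(v)\big),\quad s,k,i\in\mathbb N,\ s+k+i=n,\ 1\le l\le\dim\mathcal M_k(\mathbb R^p,\mathbb C_p),\ 1\le j\le\dim\mathcal M_i(\mathbb R^q,\mathbb C_q),$$ form an orthogonal basis of $\mathcal M_n(\mathbb R^m,\mathbb C_m)$.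
   Context: $\mathbb N=\{0,1,2,\dots\}$. $\mathbb C_m$ is the complex Clifford algebra generated by $e_1,\dots,e_m$ with $e_ie_j+e_je_i=-2\delta_{ij}$; $\mathbb C_p$ is the subalgebra generated by $e_1,\dots,e_p$ (a basis of $\mathbb R^p$) and $\mathbb C_q$ the subalgebra generated by $e_{p+1},\dots,e_m$ (a basis of $\mathbb R^q$). All products are in $\mathbb C_m$; vectors are identified with Clifford algebra elements, e.g. $x=\sum_jx_je_j$. $\mathcal P(\mathbb R^d,\mathbb C_d)$ is the space of $\mathbb C_d$-valued polynomials on $\mathbb R^d$; $\mathcal M(\mathbb R^d,\mathbb C_d)$ is its subspace of monogenic polynomials, i.e. those annihilated by the Dirac operator $\sum_je_j\partial_{x_j}$ of $\mathbb R^d$ acting from the left; $\mathcal M_k(\mathbb R^d,\mathbb C_d)$ is the subspace of those homogeneous of degree $k$. Dimensions and bases are over $\mathbb C$. $P_M$ is the projection of $\mathcal P(\mathbb R^m,\mathbb C_m)$ onto the $s=0$ summand of the Fischer decomposition $\mathcal P(\mathbb R^m,\mathbb C_m)=\bigoplus_{s\ge0}x^s\mathcal M(\mathbb R^m,\mathbb C_m)$. Orthogonality and orthonormality refer to the Fischer inner products: for $P=\sum_AP_A(x)e_A$ and $Q$ in $\mathcal P(\mathbb R^d,\mathbb C_d)$, $\langle P,Q\rangle_d=[\bar P(\partial_x)Q(x)]_0|_{x=0}$, where $[\cdot]_0$ is the scalar part and $\bar P(\partial_x)=\sum_A\overline{P_A}(\partial_{x_1},\dots,\partial_{x_d})\bar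 e_A$, with $\overline{P_A}$ having complex conjugated coefficients and $\bar{\cdot}$ on $e_A$ the anti-involution with $\bar e_j=-e_j$. *)

theory Defs
  imports Complex_Main "HOL-Library.Poly_Mapping"
begin

section \<open>The complex Clifford algebra\<close>

text \<open>
  One type holds the complex Clifford algebra on the generators \<open>e\<^sub>0, e\<^sub>1, e\<^sub>2, \<dots>\<close>: an element is
  given by its finitely many coordinates with respect to the blades \<open>e\<^sub>A\<close>, where \<open>A\<close> is a finite
  set of natural numbers and \<open>e\<^sub>A\<close> is the product of the \<open>e\<^sub>j\<close>, \<open>j \<in> A\<close>, in increasing order.
  The algebra of a subspace spanned by some of the basis vectors is the corresponding subalgebra
  (\<open>clifford_alg\<close> below), so that all products are formed in one ambient algebra.
\<close>

typedef clifford =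
  "{f :: nat set \<Rightarrow> complex. finite {A. f A \<noteq> 0} \<and> (\<forall>A. f A \<noteq> 0 \<longrightarrow> finite A)}"
  morphisms blade_coeff Abs_clifford
  by (rule exI[of _ "\<lambda>_. 0"]) simp

setup_lifting type_definition_clifford

lemma clifford_eqI: "(\<And>A. blade_coeff a A = blade_coeff b A) \<Longrightarrow> a = b"
  using blade_coeff_inject by blast

lemma finite_blade_support [simp]: "finite {A. blade_coeff a A \<noteq> 0}"
  using blade_coeff[of a] by auto

lemma finite_blade: "blade_coeff a A \<noteq> 0 \<Longrightarrow> finite A"
  using blade_coeff[of a] by auto

text \<open>
  \<open>e\<^sub>A e\<^sub>B = blade_sign A B \<cdot> e\<^bsub>A \<triangle> B\<^esub>\<close>: sorting the product swaps every pair \<open>a \<in> A\<close>, \<open>b \<in> B\<close> with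
  \<open>b < a\<close> once, and every common index contributes \<open>e\<^sub>a\<^sup>2 = -1\<close>.
\<close>

definition blade_sign :: "nat set \<Rightarrow> nat set \<Rightarrow> complex" where
  "blade_sign A B = (\<Prod>a\<in>A. \<Prod>b\<in>B. if b \<le> a then - 1 else 1)"

lemma prod_sym_diff_signs:
  fixes g :: "'a \<Rightarrow> 'b :: comm_ring_1"
  assumes "finite A" "finite B" "\<And>x. g x * g x = 1"
  shows "prod g (sym_diff A B) = prod g A * prod g B"
proof -
  have A: "prod g A = prod g (A - B) * prod g (A \<inter> B)"
    using prod.Int_Diff[OF assms(1), of g B] by (simp add: mult.commute)
  have B: "prod g B = prod g (B - A) * prod g (A \<inter> B)"
    using prod.Int_Diff[OF assms(2), of g A] by (simp add: mult.commute Int_commute)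
  have sq: "prod g (A \<inter> B) * prod g (A \<inter> B) = 1"
    by (simp add: prod.distrib[symmetric] assms(3))
  have "prod g (sym_diff A B) = prod g (A - B) * prod g (B - A)"
    using assms by (intro prod.union_disjoint) auto
  also have "\<dots> = prod g A * prod g B"
    unfolding A B using sq by (metis mult.assoc mult.commute mult.right_neutral)
  finally show ?thesis .
qed

lemma blade_sign_sq [simp]: "blade_sign A B * blade_sign A B = 1"
  unfolding blade_sign_def prod.distrib[symmetric] by (intro prod.neutral ballI) simp

lemma blade_sign_left:
  assumes "finite A" "finite B"
  shows "blade_sign (sym_diff A B) C = blade_sign A C * blade_sign B C"
  unfolding blade_sign_def
  by (rule prod_sym_diff_signs[OF assms], unfold prod.distrib[symmetric])
    (intro prod.neutral ballI, simp)

lemma blade_sign_right: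
  assumes "finite B" "finite C"
  shows "blade_sign A (sym_diff B C) = blade_sign A B * blade_sign A C"
  unfolding blade_sign_def prod.distrib[symmetric]
  by (intro prod.cong refl prod_sym_diff_signs) (use assms in auto)

lemma blade_sign_empty [simp]: "blade_sign {} B = 1" "blade_sign A {} = 1"
  by (simp_all add: blade_sign_def)

lemma sym_diff_cancel: "sym_diff A (sym_diff A C) = C"
  by auto

lemma finite_sym_diff_iff: "finite A \<Longrightarrow> finite (sym_diff A C) \<longleftrightarrow> finite C"
  by (metis finite_Diff finite_UnI sym_diff_cancel)

instantiation clifford :: ab_group_add
begin

lift_definition zero_clifford :: clifford is "\<lambda>_. 0" by simp

lift_definition plus_clifford :: "clifford \<Rightarrow> clifford \<Rightarrow> clifford" is "\<lambda>f g A. f A + g A"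
proof -
  fix f g :: "nat set \<Rightarrow> complex"
  assume f: "finite {A. f A \<noteq> 0} \<and> (\<forall>A. f A \<noteq> 0 \<longrightarrow> finite A)"
    and g: "finite {A. g A \<noteq> 0} \<and> (\<forall>A. g A \<noteq> 0 \<longrightarrow> finite A)"
  have "finite {A. f A + g A \<noteq> 0}"
    by (rule finite_subset[of _ "{A. f A \<noteq> 0} \<union> {A. g A \<noteq> 0}"]) (use f g in auto)
  then show "finite {A. f A + g A \<noteq> 0} \<and> (\<forall>A. f A + g A \<noteq> 0 \<longrightarrow> finite A)"
    using f g by (metis add.right_neutral)
qed

lift_definition uminus_clifford :: "clifford \<Rightarrow> clifford" is "\<lambda>f A. - f A" by simp

definition minus_clifford :: "clifford \<Rightarrow> clifford \<Rightarrow> clifford" where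
  "minus_clifford a b = a + - b"

instance
  by standard (simp_all add: minus_clifford_def, (transfer, simp add: fun_eq_iff algebra_simps)+)

end

lemma blade_coeff_simps [simp]:
  "blade_coeff 0 A = 0"
  "blade_coeff (a + b) A = blade_coeff a A + blade_coeff b A"
  "blade_coeff (- a) A = - blade_coeff a A"
  by (transfer, simp)+

lemma blade_coeff_sum: "blade_coeff (sum f S) A = (\<Sum>x\<in>S. blade_coeff (f x) A)"
  by (induction S rule: infinite_finite_induct) auto

instantiation clifford :: ring_1
begin

lift_definition one_clifford :: clifford is "\<lambda>A. if A = {} then 1 else 0"
  by simp

text \<open>The coordinate at \<open>e\<^sub>C\<close> collects the products \<open>e\<^sub>A e\<^sub>B\<close> with \<open>A \<triangle> B = C\<close>, that is
  \<open>B = A \<triangle> C\<close>.\<close>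

lift_definition times_clifford :: "clifford \<Rightarrow> clifford \<Rightarrow> clifford" is
  "\<lambda>f g C. \<Sum>A | f A \<noteq> 0. blade_sign A (sym_diff A C) * f A * g (sym_diff A C)"
proof -
  fix f g :: "nat set \<Rightarrow> complex"
  assume f: "finite {A. f A \<noteq> 0} \<and> (\<forall>A. f A \<noteq> 0 \<longrightarrow> finite A)"
    and g: "finite {A. g A \<noteq> 0} \<and> (\<forall>A. g A \<noteq> 0 \<longrightarrow> finite A)"
  define h where
    "h = (\<lambda>C. \<Sum>A | f A \<noteq> 0. blade_sign A (sym_diff A C) * f A * g (sym_diff A C))"
  have ex: "\<exists>A. f A \<noteq> 0 \<and> g (sym_diff A C) \<noteq> 0" if "h C \<noteq> 0" for C
  proof (rule ccontr)
    assume "\<not> ?thesis"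
    then have "h C = 0"
      unfolding h_def by (intro sum.neutral) auto
    then show False
      using that by simp
  qed
  have sub: "{C. h C \<noteq> 0} \<subseteq> (\<lambda>(A, B). sym_diff A B) ` ({A. f A \<noteq> 0} \<times> {A. g A \<noteq> 0})"
  proof
    fix C assume "C \<in> {C. h C \<noteq> 0}"
    then obtain A where "f A \<noteq> 0" "g (sym_diff A C) \<noteq> 0"
      using ex by blast
    moreover have "C = (\<lambda>(A, B). sym_diff A B) (A, sym_diff A C)"
      by auto
    ultimately show "C \<in> (\<lambda>(A, B). sym_diff A B) ` ({A. f A \<noteq> 0} \<times> {A. g A \<noteq> 0})"
      by blast
  qed
  have "finite {C. h C \<noteq> 0}"
    by (rule finite_subset[OF sub]) (use f g in auto)
  moreover have "finite C" if "h C \<noteq> 0" for C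
  proof -
    obtain A where "f A \<noteq> 0" "g (sym_diff A C) \<noteq> 0"
      using ex \<open>h C \<noteq> 0\<close> by blast
    then have "finite A" "finite (sym_diff A C)"
      using f g by blast+
    then show ?thesis
      by (rule finite_sym_diff_iff[THEN iffD1])
  qed
  ultimately show "finite {C. h C \<noteq> 0} \<and> (\<forall>C. h C \<noteq> 0 \<longrightarrow> finite C)"
    by blast
qed

lemma blade_coeff_times:
  assumes "finite N" "{A. blade_coeff a A \<noteq> 0} \<subseteq> Pow N"
  shows "blade_coeff (a * b) C =
    (\<Sum>A\<in>Pow N. blade_sign A (sym_diff A C) * blade_coeff a A * blade_coeff b (sym_diff A C))"
proof -
  have "blade_coeff (a * b) C = (\<Sum>A | blade_coeff a A \<noteq> 0.
      blade_sign A (sym_diff A C) * blade_coeff a A * blade_coeff b (sym_diff A C))"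
    by transfer simp
  also have "\<dots> = (\<Sum>A\<in>Pow N.
      blade_sign A (sym_diff A C) * blade_coeff a A * blade_coeff b (sym_diff A C))"
    by (rule sum.mono_neutral_left) (use assms in auto)
  finally show ?thesis .
qed

lemma blade_coeff_times_subset:
  assumes "{A. blade_coeff a A \<noteq> 0} \<subseteq> Pow N" "{A. blade_coeff b A \<noteq> 0} \<subseteq> Pow N"
    and "blade_coeff (a * b) C \<noteq> 0"
  shows "C \<subseteq> N"
proof (rule ccontr)
  assume C: "\<not> C \<subseteq> N"
  have eq: "blade_coeff (a * b) C = (\<Sum>A | blade_coeff a A \<noteq> 0.
      blade_sign A (sym_diff A C) * blade_coeff a A * blade_coeff b (sym_diff A C))"
    by transfer simp
  have "blade_coeff b (sym_diff A C) = 0" if "blade_coeff a A \<noteq> 0" for A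
    using that assms(1,2) C by blast
  then have "blade_coeff (a * b) C = 0"
    unfolding eq by (intro sum.neutral) simp
  then show False
    using assms(3) by simp
qed

lemma common_blade_bound:
  obtains N where "finite N" "{A. blade_coeff a A \<noteq> 0} \<subseteq> Pow N"
    "{A. blade_coeff b A \<noteq> 0} \<subseteq> Pow N" "{A. blade_coeff c A \<noteq> 0} \<subseteq> Pow N"
proof -
  define S where "S = {A. blade_coeff a A \<noteq> 0} \<union> {A. blade_coeff b A \<noteq> 0}
    \<union> {A. blade_coeff c A \<noteq> 0}"
  have "finite (\<Union>S)"
    unfolding S_def by (intro finite_Union) (auto dest: finite_blade)
  then show ?thesis
    by (rule that) (auto simp: S_def)
qed

lemma sum_Pow_sym_diff:
  assumes "B \<subseteq> N"
  shows "(\<Sum>A\<in>Pow N. F (sym_diff B A)) = (\<Sum>A\<in>Pow N. F A)"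
  by (rule sum.reindex_bij_witness[of _ "sym_diff B" "sym_diff B"]) (use assms in auto)

instance
proof
  fix a b c :: clifford
  obtain N where N: "finite N" "{A. blade_coeff a A \<noteq> 0} \<subseteq> Pow N"
    "{A. blade_coeff b A \<noteq> 0} \<subseteq> Pow N" "{A. blade_coeff c A \<noteq> 0} \<subseteq> Pow N"
    by (rule common_blade_bound[of a b c]) blast
  have ab: "{A. blade_coeff (a * b) A \<noteq> 0} \<subseteq> Pow N"
    using blade_coeff_times_subset N by blast
  have apb: "{A. blade_coeff (a + b) A \<noteq> 0} \<subseteq> Pow N"
  proof
    fix A assume "A \<in> {A. blade_coeff (a + b) A \<noteq> 0}"
    then have "blade_coeff a A \<noteq> 0 \<or> blade_coeff b A \<noteq> 0"
      by (cases "blade_coeff a A = 0") auto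
    then show "A \<in> Pow N"
      using N(2,3) by blast
  qed
  have bc: "{A. blade_coeff (b * c) A \<noteq> 0} \<subseteq> Pow N"
    using blade_coeff_times_subset N by blast
  show "(a * b) * c = a * (b * c)"
  proof (rule clifford_eqI)
    fix C
    show "blade_coeff (a * b * c) C = blade_coeff (a * (b * c)) C"
    proof (cases "C \<subseteq> N")
      case False
      then show ?thesis
        using blade_coeff_times_subset[of "a * b" N c C] blade_coeff_times_subset[of a N "b * c" C]
          N ab bc by metis
    next
      case True
      have fin: "finite A" if "A \<subseteq> N" for A
        using that N(1) finite_subset by blast
      have "blade_coeff (a * (b * c)) C = (\<Sum>B\<in>Pow N. \<Sum>D\<in>Pow N.
          blade_sign B (sym_diff B C) * blade_coeff a B *
          (blade_sign D (sym_diff D (sym_diff B C)) * blade_coeff b D *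
            blade_coeff c (sym_diff D (sym_diff B C))))"
        by (simp add: blade_coeff_times[of N a, OF N(1,2)] blade_coeff_times[of N b, OF N(1,3)] sum_distrib_left)
      also have "\<dots> = (\<Sum>B\<in>Pow N. \<Sum>A\<in>Pow N.
          blade_sign B (sym_diff B C) * blade_coeff a B *
          (blade_sign (sym_diff B A) (sym_diff (sym_diff B A) (sym_diff B C)) *
            blade_coeff b (sym_diff B A) *
            blade_coeff c (sym_diff (sym_diff B A) (sym_diff B C))))"
        by (intro sum.cong refl sum_Pow_sym_diff[symmetric]) auto
      also have "\<dots> = (\<Sum>B\<in>Pow N. \<Sum>A\<in>Pow N.
          blade_sign A (sym_diff A C) * (blade_sign B (sym_diff B A) * blade_coeff a B *
          blade_coeff b (sym_diff B A)) * blade_coeff c (sym_diff A C))"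
      proof (intro sum.cong refl)
        fix A B assume "B \<in> Pow N" "A \<in> Pow N"
        then have f: "finite A" "finite B" "finite C" "finite (sym_diff A C)" "finite (sym_diff B C)"
          using fin True by auto
        have e: "sym_diff (sym_diff B A) (sym_diff B C) = sym_diff A C"
          by auto
        have "sym_diff (sym_diff B C) (sym_diff A C) = sym_diff B A"
          by auto
        then have 1: "blade_sign B (sym_diff B C) * blade_sign B (sym_diff A C)
            = blade_sign B (sym_diff B A)"
          using blade_sign_right[OF f(5,4), of B] by simp
        have 2: "blade_sign (sym_diff B A) (sym_diff A C)
            = blade_sign B (sym_diff A C) * blade_sign A (sym_diff A C)"
          by (rule blade_sign_left) (use f in auto)
        show "blade_sign B (sym_diff B C) * blade_coeff a B *
          (blade_sign (sym_diff B A) (sym_diff (sym_diff B A) (sym_diff B C)) *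
            blade_coeff b (sym_diff B A) *
            blade_coeff c (sym_diff (sym_diff B A) (sym_diff B C))) =
          blade_sign A (sym_diff A C) * (blade_sign B (sym_diff B A) * blade_coeff a B *
          blade_coeff b (sym_diff B A)) * blade_coeff c (sym_diff A C)"
          unfolding e 2 1[symmetric] by (simp only: mult_ac)
      qed
      also have "\<dots> = blade_coeff (a * b * c) C"
        by (simp only: blade_coeff_times[of N "a * b", OF N(1) ab] blade_coeff_times[of N a, OF N(1,2)]
          sum_distrib_left sum_distrib_right) (rule sum.swap)
      finally show ?thesis ..
    qed
  qed
  show "1 * a = a"
    by (rule clifford_eqI, transfer) (simp add: if_distrib cong: if_cong)
  have one: "\<And>A. blade_coeff (1 :: clifford) A = (if A = {} then 1 else 0)"
    by transfer simp
  show "a * 1 = a"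
  proof (rule clifford_eqI)
    fix C
    have "blade_coeff (a * 1) C
      = (\<Sum>A\<in>Pow N. if A = C then blade_coeff a A else 0)"
      by (simp only: blade_coeff_times[of N a, OF N(1,2)] one) (intro sum.cong refl, auto)
    also have "\<dots> = blade_coeff a C"
      using N(1,2) by auto
    finally show "blade_coeff (a * 1) C = blade_coeff a C" .
  qed
  show "(a + b) * c = a * c + b * c"
    by (rule clifford_eqI, simp only: blade_coeff_times[of N "a + b", OF N(1) apb]
        blade_coeff_times[of N a, OF N(1,2)] blade_coeff_times[of N b, OF N(1,3)]
        blade_coeff_simps sum.distrib[symmetric])
      (intro sum.cong refl, simp only: distrib_left distrib_right)
  show "a * (b + c) = a * b + a * c"
    by (rule clifford_eqI, simp only: blade_coeff_times[of N a, OF N(1,2)]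
        blade_coeff_simps sum.distrib[symmetric])
      (intro sum.cong refl, simp only: distrib_left distrib_right)
  show "(0 :: clifford) \<noteq> 1"
    using one[of "{}"] by (metis blade_coeff_simps(1) zero_neq_one)
qed

end

lift_definition clifford_const :: "complex \<Rightarrow> clifford" is "\<lambda>c A. if A = {} then c else 0"
  by simp

lift_definition blade :: "nat set \<Rightarrow> clifford" is "\<lambda>A B. if finite A \<and> B = A then 1 else 0"
  by (auto intro: finite_subset[of _ "{A}" for A])

definition gen :: "nat \<Rightarrow> clifford" where
  "gen j = blade {j}"

lemma blade_coeff_const [simp]: "blade_coeff (clifford_const c) A = (if A = {} then c else 0)"
  by transfer simp

lemma blade_coeff_one [simp]: "blade_coeff 1 A = (if A = {} then 1 else 0)"
  by transfer simp

lemma blade_coeff_blade: "finite A \<Longrightarrow> blade_coeff (blade A) B = (if B = A then 1 else 0)"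
  by transfer simp

lemma blade_coeff_const_times [simp]:
  "blade_coeff (clifford_const c * a) A = c * blade_coeff a A"
  by (subst blade_coeff_times[of "{}"]) (auto split: if_splits)

lemma blade_coeff_times_const [simp]:
  "blade_coeff (a * clifford_const c) A = c * blade_coeff a A"
proof -
  obtain N where N: "finite N" "{A. blade_coeff a A \<noteq> 0} \<subseteq> Pow N"
    by (rule common_blade_bound[of a a a]) blast
  have "blade_coeff (a * clifford_const c) A
      = (\<Sum>B\<in>Pow N. if B = A then c * blade_coeff a B else 0)"
    by (subst blade_coeff_times[OF N], intro sum.cong refl) auto
  also have "\<dots> = c * blade_coeff a A"
    using N by auto
  finally show ?thesis .
qed

lemma clifford_const_simps [simp]:
  "clifford_const 0 = 0" "clifford_const 1 = 1"
  by (rule clifford_eqI, simp)+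

lemma clifford_const_add: "clifford_const (c + d) = clifford_const c + clifford_const d"
  by (rule clifford_eqI) simp

lemma clifford_const_mult: "clifford_const (c * d) = clifford_const c * clifford_const d"
  by (rule clifford_eqI) simp

lemma clifford_const_commute: "clifford_const c * a = a * clifford_const c"
  by (rule clifford_eqI) simp

lemma blade_times_blade:
  assumes "finite A" "finite B"
  shows "blade A * blade B = clifford_const (blade_sign A B) * blade (sym_diff A B)"
proof (rule clifford_eqI)
  fix C
  have sub: "{D. blade_coeff (blade A) D \<noteq> 0} \<subseteq> Pow A"
    using assms by (auto simp: blade_coeff_blade split: if_splits)
  have "blade_coeff (blade A * blade B) C = (\<Sum>D\<in>Pow A. if D = A
      then blade_sign A (sym_diff A C) * blade_coeff (blade B) (sym_diff A C) else 0)"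
    unfolding blade_coeff_times[OF assms(1) sub] blade_coeff_blade[OF assms(1)]
    by (intro sum.cong refl) simp
  also have "\<dots> = blade_sign A (sym_diff A C) * blade_coeff (blade B) (sym_diff A C)"
    using assms(1) by (subst sum.delta) simp_all
  also have "\<dots> = (if C = sym_diff A B then blade_sign A B else 0)"
  proof (cases "C = sym_diff A B")
    case True
    then have "sym_diff A C = B"
      by (simp only: sym_diff_cancel)
    then show ?thesis
      using True assms(2) by (simp only: blade_coeff_blade refl if_True mult_1_right)
  next
    case False
    then have "sym_diff A C \<noteq> B"
      using sym_diff_cancel[of A C] by metis
    then show ?thesis
      using False assms(2) by (simp only: blade_coeff_blade if_False mult_zero_right)
  qed
  also have "\<dots> = blade_coeff (clifford_const (blade_sign A B) * blade (sym_diff A B)) C"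
    using assms by (simp add: blade_coeff_blade)
  finally show "blade_coeff (blade A * blade B) C
    = blade_coeff (clifford_const (blade_sign A B) * blade (sym_diff A B)) C" .
qed

lemma gen_relation: "gen i * gen j + gen j * gen i = (if i = j then - 2 else 0)"
proof (cases "i = j")
  case True
  have "gen i * gen i = - 1"
    unfolding gen_def
    by (rule clifford_eqI) (simp add: blade_times_blade blade_sign_def blade_coeff_blade)
  then show ?thesis
    using True by simp
next
  case False
  show ?thesis
    unfolding gen_def
    by (rule clifford_eqI)
      (use False in \<open>simp add: blade_times_blade blade_sign_def blade_coeff_blade Un_commute
        insert_Diff_if\<close>)
qed

text \<open>The subalgebra generated by the \<open>e\<^sub>j\<close> with \<open>j \<in> I\<close>.\<close>

inductive_set clifford_alg :: "nat set \<Rightarrow> clifford set" for I where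
  const: "clifford_const c \<in> clifford_alg I"
| gen: "j \<in> I \<Longrightarrow> gen j \<in> clifford_alg I"
| add: "a \<in> clifford_alg I \<Longrightarrow> b \<in> clifford_alg I \<Longrightarrow> a + b \<in> clifford_alg I"
| mult: "a \<in> clifford_alg I \<Longrightarrow> b \<in> clifford_alg I \<Longrightarrow> a * b \<in> clifford_alg I"

lemma blade_in_clifford_alg:
  assumes "finite A" "A \<subseteq> I"
  shows "blade A \<in> clifford_alg I"
  using assms
proof (induction A rule: finite_linorder_max_induct)
  case empty
  have "blade {} = clifford_const 1"
    by (rule clifford_eqI) (simp add: blade_coeff_blade)
  then show ?case
    using clifford_alg.const by metis
next
  case (insert b A)
  have "blade_sign A {b} = 1"
    unfolding blade_sign_def using insert by (auto intro!: prod.neutral)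
  moreover have "sym_diff A {b} = insert b A"
    using insert by auto
  ultimately have "blade (insert b A) = blade A * gen b"
    using insert by (simp add: gen_def blade_times_blade)
  then show ?case
    using insert by (auto intro: clifford_alg.intros)
qed

lemma clifford_alg_eq: "clifford_alg I = {a. \<forall>A. blade_coeff a A \<noteq> 0 \<longrightarrow> A \<subseteq> I}"
proof (intro equalityI subsetI)
  fix a assume "a \<in> clifford_alg I"
  then show "a \<in> {a. \<forall>A. blade_coeff a A \<noteq> 0 \<longrightarrow> A \<subseteq> I}"
  proof induction
    case (add a b)
    then show ?case by simp (metis add.right_neutral)
  next
    case (mult a b)
    then show ?case using blade_coeff_times_subset[of a I b] by blast
  qed (auto simp: gen_def blade_coeff_blade split: if_splits)
next
  fix a assume a: "a \<in> {a. \<forall>A. blade_coeff a A \<noteq> 0 \<longrightarrow> A \<subseteq> I}"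
  have sum: "sum f S \<in> clifford_alg I" if "\<And>A. A \<in> S \<Longrightarrow> f A \<in> clifford_alg I"
    for f and S :: "nat set set"
    using that
  proof (induction S rule: infinite_finite_induct)
    case (insert x S)
    then show ?case by (simp add: clifford_alg.add)
  qed (use clifford_alg.const[of 0 I] in simp_all)
  have "a = (\<Sum>A | blade_coeff a A \<noteq> 0. clifford_const (blade_coeff a A) * blade A)"
    (is "_ = ?s")
  proof (rule clifford_eqI)
    fix B
    have "blade_coeff ?s B
        = (\<Sum>A | blade_coeff a A \<noteq> 0. if B = A then blade_coeff a A else 0)"
      unfolding blade_coeff_sum
      by (intro sum.cong refl) (simp add: blade_coeff_blade finite_blade)
    also have "\<dots> = blade_coeff a B"
      by simp
    finally show "blade_coeff a B = blade_coeff ?s B" ..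
  qed
  also have "?s \<in> clifford_alg I"
    using a by (intro sum clifford_alg.mult clifford_alg.const blade_in_clifford_alg)
      (auto dest: finite_blade)
  finally show "a \<in> clifford_alg I" .
qed

text \<open>
  The conjugation: complex conjugation on coordinates, combined with the anti-involution that
  maps \<open>e\<^sub>j\<close> to \<open>-e\<^sub>j\<close>. The latter maps \<open>e\<^sub>A\<close> to its inverse \<open>blade_sign A A \<cdot> e\<^sub>A\<close>. The lemmas below
  determine this map on every \<open>clifford_alg I\<close>.
\<close>

lift_definition clifford_conj :: "clifford \<Rightarrow> clifford" is
  "\<lambda>f A. blade_sign A A * cnj (f A)"
  by (auto elim: rev_finite_subset)

lemma blade_sign_nonzero [simp]: "blade_sign A B \<noteq> 0"
  using blade_sign_sq[of A B] by (metis mult_zero_left zero_neq_one)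

lemma cnj_blade_sign [simp]: "cnj (blade_sign A B) = blade_sign A B"
  unfolding blade_sign_def by (simp add: if_distrib cong: if_cong)

lemma blade_coeff_conj [simp]: "blade_coeff (clifford_conj a) A = blade_sign A A * cnj (blade_coeff a A)"
  by transfer simp

lemma clifford_conj_const: "clifford_conj (clifford_const c) = clifford_const (cnj c)"
  by (rule clifford_eqI) simp

lemma clifford_conj_gen: "clifford_conj (gen j) = - gen j"
  by (rule clifford_eqI) (simp add: gen_def blade_coeff_blade blade_sign_def)

lemma clifford_conj_add: "clifford_conj (a + b) = clifford_conj a + clifford_conj b"
  by (rule clifford_eqI) (simp add: algebra_simps)

lemma clifford_conj_mult: "clifford_conj (a * b) = clifford_conj b * clifford_conj a"
proof (rule clifford_eqI)
  fix C
  obtain N where N: "finite N" "{A. blade_coeff a A \<noteq> 0} \<subseteq> Pow N"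
    "{A. blade_coeff b A \<noteq> 0} \<subseteq> Pow N"
    by (rule common_blade_bound[of a b b]) blast
  have N': "{A. blade_coeff (clifford_conj a) A \<noteq> 0} \<subseteq> Pow N"
    "{A. blade_coeff (clifford_conj b) A \<noteq> 0} \<subseteq> Pow N"
    using N by auto
  show "blade_coeff (clifford_conj (a * b)) C = blade_coeff (clifford_conj b * clifford_conj a) C"
  proof (cases "C \<subseteq> N")
    case False
    then have "blade_coeff (a * b) C = 0"
      using blade_coeff_times_subset[of a N b C] N by blast
    moreover have "blade_coeff (clifford_conj b * clifford_conj a) C = 0"
      using blade_coeff_times_subset[of "clifford_conj b" N "clifford_conj a" C] N' False by blast
    ultimately show ?thesis by simp
  next
    case True
    have "blade_coeff (clifford_conj b * clifford_conj a) C = (\<Sum>B\<in>Pow N.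
        blade_sign B (sym_diff B C) * blade_coeff (clifford_conj b) B *
        blade_coeff (clifford_conj a) (sym_diff B C))"
      by (rule blade_coeff_times[OF N(1) N'(2)])
    also have "\<dots> = (\<Sum>A\<in>Pow N.
        blade_sign (sym_diff C A) (sym_diff (sym_diff C A) C) *
        blade_coeff (clifford_conj b) (sym_diff C A) *
        blade_coeff (clifford_conj a) (sym_diff (sym_diff C A) C))"
      by (rule sum_Pow_sym_diff[OF True, symmetric])
    also have "\<dots> = (\<Sum>A\<in>Pow N. blade_sign C C *
        cnj (blade_sign A (sym_diff A C) * blade_coeff a A * blade_coeff b (sym_diff A C)))"
    proof (intro sum.cong refl)
      fix A assume "A \<in> Pow N"
      define B where "B = sym_diff A C"
      have f: "finite A" "finite B"
        using \<open>A \<in> Pow N\<close> True N(1) by (auto simp: B_def intro: finite_subset)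
      have e: "sym_diff C A = B" "sym_diff A C = B" "sym_diff B C = A" "C = sym_diff A B"
        by (auto simp: B_def)
      have "blade_sign C C = blade_sign A A * blade_sign A B * (blade_sign B A * blade_sign B B)"
        using f unfolding e(4) by (simp add: blade_sign_left blade_sign_right)
      then have "blade_sign C C * blade_sign A B
          = blade_sign A A * (blade_sign A B * blade_sign A B) * blade_sign B A * blade_sign B B"
        by (simp only: mult_ac)
      then have *: "blade_sign C C * blade_sign A B
          = blade_sign A A * blade_sign B A * blade_sign B B"
        by simp
      have "blade_sign (sym_diff C A) (sym_diff (sym_diff C A) C) *
          blade_coeff (clifford_conj b) (sym_diff C A) *
          blade_coeff (clifford_conj a) (sym_diff (sym_diff C A) C)
        = (blade_sign A A * blade_sign B A * blade_sign B B) * cnj (blade_coeff a A)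
          * cnj (blade_coeff b B)"
        unfolding e(1,3) by (simp add: mult_ac)
      also have "\<dots> = blade_sign C C *
          cnj (blade_sign A (sym_diff A C) * blade_coeff a A * blade_coeff b (sym_diff A C))"
        unfolding e(2) *[symmetric] by (simp add: mult_ac)
      finally show "blade_sign (sym_diff C A) (sym_diff (sym_diff C A) C) *
          blade_coeff (clifford_conj b) (sym_diff C A) *
          blade_coeff (clifford_conj a) (sym_diff (sym_diff C A) C) = blade_sign C C *
          cnj (blade_sign A (sym_diff A C) * blade_coeff a A * blade_coeff b (sym_diff A C))" .
    qed
    also have "\<dots> = blade_coeff (clifford_conj (a * b)) C"
      by (simp add: blade_coeff_times[of N a, OF N(1,2)] sum_distrib_left)
    finally show ?thesis ..
  qed
qed

definition scalar_part :: "clifford \<Rightarrow> complex" where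
  "scalar_part a = blade_coeff a {}"


section \<open>Clifford-valued polynomials\<close>

text \<open>
  A polynomial is the finitely supported family of its Clifford coefficients, indexed by exponent
  vectors. The multiplication is that of \<^theory>\<open>HOL-Library.Poly_Mapping\<close>: the variables \<open>x\<^sub>j\<close> are
  real, so they commute with the coefficients. The space \<open>\<real>\<^sup>d\<close> enters through the set \<open>I\<close> of the
  indices of its coordinates.
\<close>

type_synonym clifford_poly = "(nat \<Rightarrow>\<^sub>0 nat) \<Rightarrow>\<^sub>0 clifford"

abbreviation poly_const :: "clifford \<Rightarrow> clifford_poly" where
  "poly_const a \<equiv> Poly_Mapping.single 0 a"

definition poly_scale :: "complex \<Rightarrow> clifford_poly \<Rightarrow> clifford_poly" where
  "poly_scale c F = poly_const (clifford_const c) * F"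

global_interpretation cpoly: vector_space poly_scale
  by standard
    (simp_all add: poly_scale_def algebra_simps clifford_const_add clifford_const_mult single_add
      mult_single flip: mult.assoc)

definition clifford_polys :: "nat set \<Rightarrow> clifford_poly set" where
  "clifford_polys I = {F. \<forall>\<alpha>\<in>Poly_Mapping.keys F.
     Poly_Mapping.keys \<alpha> \<subseteq> I \<and> Poly_Mapping.lookup F \<alpha> \<in> clifford_alg I}"

definition homogeneous :: "nat \<Rightarrow> clifford_poly \<Rightarrow> bool" where
  "homogeneous k F \<longleftrightarrow>
     (\<forall>\<alpha>\<in>Poly_Mapping.keys F. (\<Sum>j\<in>Poly_Mapping.keys \<alpha>. Poly_Mapping.lookup \<alpha> j) = k)"

definition vec_var :: "nat set \<Rightarrow> clifford_poly" where
  "vec_var I = (\<Sum>j\<in>I. Poly_Mapping.single (Poly_Mapping.single j 1) (gen j))"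

text \<open>The summands with \<open>\<alpha>\<^sub>j = 0\<close>, where the subtraction of exponents truncates, vanish.\<close>

definition partial_deriv :: "nat \<Rightarrow> clifford_poly \<Rightarrow> clifford_poly" where
  "partial_deriv j F = (\<Sum>\<alpha>\<in>Poly_Mapping.keys F.
     Poly_Mapping.single (\<alpha> - Poly_Mapping.single j 1)
       (of_nat (Poly_Mapping.lookup \<alpha> j) * Poly_Mapping.lookup F \<alpha>))"

definition multi_deriv :: "(nat \<Rightarrow>\<^sub>0 nat) \<Rightarrow> clifford_poly \<Rightarrow> clifford_poly" where
  "multi_deriv \<alpha> = foldr (\<lambda>j. partial_deriv j ^^ Poly_Mapping.lookup \<alpha> j)
     (sorted_list_of_set (Poly_Mapping.keys \<alpha>))"

definition dirac :: "nat set \<Rightarrow> clifford_poly \<Rightarrow> clifford_poly" where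
  "dirac I F = (\<Sum>j\<in>I. poly_const (gen j) * partial_deriv j F)"

definition monogenics :: "nat set \<Rightarrow> clifford_poly set" where
  "monogenics I = {F \<in> clifford_polys I. dirac I F = 0}"

definition homogeneous_monogenics :: "nat set \<Rightarrow> nat \<Rightarrow> clifford_poly set" where
  "homogeneous_monogenics I k = {F \<in> monogenics I. homogeneous k F}"

text \<open>
  The component with \<open>s = 0\<close> in the Fischer decomposition \<open>F = (\<Sum>s. x\<^sup>s f\<^sub>s)\<close> with monogenic \<open>f\<^sub>s\<close>,
  almost all of them zero.
\<close>

definition monogenic_proj :: "nat set \<Rightarrow> clifford_poly \<Rightarrow> clifford_poly" where
  "monogenic_proj I F = (THE G. \<exists>f. (\<forall>s. f s \<in> monogenics I) \<and> finite {s. f s \<noteq> 0} \<and>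
     F = (\<Sum>s | f s \<noteq> 0. vec_var I ^ s * f s) \<and> G = f 0)"


section \<open>The Fischer inner product\<close>

text \<open>\<open>conj_diff_op P F\<close> is the differential operator obtained from the conjugate of \<open>P\<close> by replacing
  \<open>x\<^sub>j\<close> with \<open>\<partial>\<^sub>j\<close>, applied to \<open>F\<close>. The inner product does not depend on the ambient space, so it
  carries no index set.\<close>

definition conj_diff_op :: "clifford_poly \<Rightarrow> clifford_poly \<Rightarrow> clifford_poly" where
  "conj_diff_op P F = (\<Sum>\<alpha>\<in>Poly_Mapping.keys P.
     poly_const (clifford_conj (Poly_Mapping.lookup P \<alpha>)) * multi_deriv \<alpha> F)"

definition fischer_inner :: "clifford_poly \<Rightarrow> clifford_poly \<Rightarrow> complex" where
  "fischer_inner P Q = scalar_part (Poly_Mapping.lookup (conj_diff_op P Q) 0)"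

definition is_basis :: "'i set \<Rightarrow> ('i \<Rightarrow> clifford_poly) \<Rightarrow> clifford_poly set \<Rightarrow> bool" where
  "is_basis J b V \<longleftrightarrow> inj_on b J \<and> cpoly.independent (b ` J) \<and> cpoly.span (b ` J) = V"

definition orthogonal_basis :: "'i set \<Rightarrow> ('i \<Rightarrow> clifford_poly) \<Rightarrow> clifford_poly set \<Rightarrow> bool" where
  "orthogonal_basis J b V \<longleftrightarrow> is_basis J b V \<and>
     (\<forall>x\<in>J. \<forall>y\<in>J. x \<noteq> y \<longrightarrow> fischer_inner (b x) (b y) = 0)"

definition orthonormal_basis :: "'i set \<Rightarrow> ('i \<Rightarrow> clifford_poly) \<Rightarrow> clifford_poly set \<Rightarrow> bool" where
  "orthonormal_basis J b V \<longleftrightarrow> orthogonal_basis J b V \<and> (\<forall>x\<in>J. fischer_inner (b x) (b x) = 1)"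

end

theory Submission
  imports Defs
begin

text \<open>
  Write \<open>\<partial>\<close> for the Dirac operator of \<open>\<real>\<^sup>m\<close> and \<open>F = u\<^sup>s P\<^sub>k Q\<^sub>i\<close>. On polynomials homogeneous of
  degree \<open>n\<close> the projection is \<open>P\<^sub>M F = (\<Sum>j. c\<^sub>j x\<^sup>j \<partial>\<^sup>j F)\<close> with explicit scalars, because
  \<open>\<partial> (x\<^sup>j G)\<close> is a combination of \<open>x\<^sup>j \<partial> G\<close> and \<open>x\<^bsup>j-1\<^esup> G\<close>. Multiplication by \<open>x\<close> and \<open>- \<partial>\<close> are
  adjoint for the Fischer inner product, so \<open>\<langle>P\<^sub>M F, P\<^sub>M F'\<rangle> = \<langle>F, P\<^sub>M F'\<rangle>\<close> is a combination of the
  numbers \<open>\<langle>\<partial>\<^sup>j F, \<partial>\<^sup>j F'\<rangle>\<close>. Since \<open>\<partial>\<^sup>j F\<close> is a multiple of \<open>u\<^bsup>s-j\<^esup> P\<^sub>k Q\<^sub>i\<close>, orthogonality of the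
  projections follows from that of the products themselves.

  \<open>P\<^sub>M F \<noteq> 0\<close> because a monogenic series \<open>G = F + (\<Sum>j>0. d\<^sub>j v\<^sup>j \<partial>\<^sup>j F)\<close> has
  \<open>\<langle>F, G\<rangle> = \<langle>F, F\<rangle>\<close>, whereas \<open>x H\<close> is orthogonal to \<open>G\<close>. The projections span because, modulo
  multiples of \<open>x\<close>, a factor \<open>v\<close> in front may be replaced by \<open>- u\<close>, which reduces every product
  \<open>A(u) B(v)\<close> to the products \<open>u\<^sup>s P\<^sub>k Q\<^sub>i\<close>.
\<close>

abbreviation "lookup \<equiv> Poly_Mapping.lookup"
abbreviation "keys \<equiv> Poly_Mapping.keys"
abbreviation "single \<equiv> Poly_Mapping.single"

section \<open>Clifford-valued polynomials\<close>

lemma poly_mapping_sum_single: "F = (\<Sum>\<alpha>\<in>keys F. single \<alpha> (lookup F \<alpha>))"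
  by (rule poly_mapping_eqI)
    (auto simp: lookup_sum lookup_single when_def in_keys_iff)

text \<open>A polynomial is the finite sum of its monomials, so a property preserved by addition
  need only be checked on \<open>single \<alpha> a\<close>.\<close>

lemma poly_mapping_additive_induct [case_names zero single add]:
  fixes F :: "'a \<Rightarrow>\<^sub>0 'b :: comm_monoid_add"
  assumes "P 0" "\<And>\<alpha> a. P (single \<alpha> a)" "\<And>F G. P F \<Longrightarrow> P G \<Longrightarrow> P (F + G)"
  shows "P F"
proof -
  have "P (\<Sum>\<alpha>\<in>S. single \<alpha> (lookup F \<alpha>))" if "finite S" for S
    using that by induction (auto intro: assms)
  from this[OF finite_keys] show ?thesis
    using arg_cong[OF poly_mapping_sum_single, of P F] by iprover
qed

lemma lookup_const_mult: "lookup (poly_const a * F) \<alpha> = a * lookup F \<alpha>"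
  by (induction F rule: poly_mapping_additive_induct)
    (auto simp: mult_single lookup_single when_def lookup_add distrib_left)

lemma lookup_poly_scale [simp]: "lookup (poly_scale c F) \<alpha> = clifford_const c * lookup F \<alpha>"
  by (simp add: poly_scale_def lookup_const_mult)

lemma poly_scale_mult_left: "poly_scale c F * G = poly_scale c (F * G)"
  by (simp add: poly_scale_def mult.assoc)

text \<open>Complex constants are central in the Clifford algebra, and exponents add commutatively.
  The ring of polynomials itself is not commutative, so this has to be proved separately from
  \<open>poly_scale_mult_left\<close>.\<close>

lemma poly_scale_mult_right: "F * poly_scale c G = poly_scale c (F * G)"
proof -
  have "F * poly_const (clifford_const c) = poly_const (clifford_const c) * F"
    by (induction F rule: poly_mapping_additive_induct)
      (simp_all add: mult_single distrib_left distrib_right clifford_const_commute)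
  then have "F * poly_const (clifford_const c) * G = poly_const (clifford_const c) * F * G"
    by (rule arg_cong)
  then show ?thesis
    by (simp only: poly_scale_def mult.assoc)
qed

lemma poly_scale_of_nat: "poly_scale (of_nat r) F = of_nat r * F"
  by (induction r)
    (simp_all only: of_nat_0 of_nat_Suc cpoly.scale_zero_left cpoly.scale_left_distrib
      cpoly.scale_one distrib_right mult_zero_left mult_1_left)

text \<open>Separates the central variable from the generator with which it is joined in
  \<open>vec_var\<close>; sign changes then concern only \<open>pgen\<close>.\<close>

definition var :: "nat \<Rightarrow> clifford_poly" where
  "var j = single (single j 1) 1"

abbreviation pgen :: "nat \<Rightarrow> clifford_poly" where
  "pgen j \<equiv> poly_const (gen j)"

lemma var_commute: "var j * F = F * var j"
  by (induction F rule: poly_mapping_additive_induct)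
    (simp_all add: var_def mult_single distrib_left distrib_right add.commute)

lemma gen_square: "gen i * gen i = - 1"
  unfolding gen_def
  by (rule clifford_eqI) (simp add: blade_times_blade blade_sign_def blade_coeff_blade)

text \<open>The trailing factor \<open>F\<close> lets the Clifford relation exchange two generators
  at the front of a right-nested product.\<close>

lemma pgen_relation: "pgen i * (pgen j * F) = (if i = j then - (2 * F) else 0) - pgen j * (pgen i * F)"
proof -
  have "pgen i * pgen j + pgen j * pgen i = (if i = j then - 2 else 0)"
    using gen_relation[of i j]
    by (simp add: mult_single single_uminus flip: single_add)
  then have "(pgen i * pgen j + pgen j * pgen i) * F = (if i = j then - 2 else 0) * F"
    by simp
  then show ?thesis
    by (auto simp: algebra_simps split: if_splits)
qed

lemma vec_var_altdef: "vec_var I = (\<Sum>j\<in>I. pgen j * var j)"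
  by (simp add: vec_var_def var_def mult_single)

lemma vec_var_mult: "vec_var I * F = (\<Sum>j\<in>I. pgen j * (var j * F))"
  by (simp add: vec_var_altdef sum_distrib_right mult.assoc)

lemma vec_var_union:
  "finite I \<Longrightarrow> finite K \<Longrightarrow> I \<inter> K = {} \<Longrightarrow> vec_var (I \<union> K) = vec_var I + vec_var K"
  unfolding vec_var_def by (rule sum.union_disjoint)

lemma dirac_union:
  "finite I \<Longrightarrow> finite K \<Longrightarrow> I \<inter> K = {} \<Longrightarrow> dirac (I \<union> K) F = dirac I F + dirac K F"
  unfolding dirac_def by (rule sum.union_disjoint)


section \<open>Partial derivatives and the Euler operator\<close>

text \<open>Truncated subtraction can be undone exactly where the exponent of the variable is
  positive; in the remaining case the derivative of the monomial has the factor 0.\<close>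

lemma exponent_minus_iff:
  "\<beta> = \<alpha> - single j (1::nat) \<and> lookup \<alpha> j \<noteq> 0 \<longleftrightarrow> \<alpha> = \<beta> + single j 1"
proof
  assume *: "\<beta> = \<alpha> - single j (1::nat) \<and> lookup \<alpha> j \<noteq> 0"
  show "\<alpha> = \<beta> + single j 1"
    using * by (intro poly_mapping_eqI) (auto simp: lookup_add lookup_minus lookup_single when_def)
qed (auto simp: lookup_add)

lemma lookup_partial_deriv:
  "lookup (partial_deriv j F) \<beta> = of_nat (lookup \<beta> j + 1) * lookup F (\<beta> + single j 1)"
proof -
  have "lookup (partial_deriv j F) \<beta> = (\<Sum>\<alpha>\<in>keys F.
      if \<alpha> = \<beta> + single j 1 then of_nat (lookup \<alpha> j) * lookup F \<alpha> else 0)"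
    unfolding partial_deriv_def lookup_sum lookup_single when_def
  proof (intro sum.cong refl)
    fix \<alpha>
    show "(if \<alpha> - single j 1 = \<beta> then of_nat (lookup \<alpha> j) * lookup F \<alpha> else 0) =
        (if \<alpha> = \<beta> + single j 1 then of_nat (lookup \<alpha> j) * lookup F \<alpha> else 0)"
      using exponent_minus_iff[of \<beta> \<alpha> j] by (cases "lookup \<alpha> j = 0") auto
  qed
  also have "\<dots> = of_nat (lookup \<beta> j + 1) * lookup F (\<beta> + single j 1)"
    by (auto simp: in_keys_iff lookup_add)
  finally show ?thesis .
qed

lemma partial_deriv_add: "partial_deriv j (F + G) = partial_deriv j F + partial_deriv j G"
  by (rule poly_mapping_eqI) (simp add: lookup_partial_deriv lookup_add distrib_left)

lemma partial_deriv_0 [simp]: "partial_deriv j 0 = 0"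
  by (simp add: partial_deriv_def)

lemma partial_deriv_minus: "partial_deriv j (- F) = - partial_deriv j F"
  by (rule poly_mapping_eqI) (simp add: lookup_partial_deriv)

lemma partial_deriv_sum: "partial_deriv j (sum f S) = (\<Sum>x\<in>S. partial_deriv j (f x))"
  by (induction S rule: infinite_finite_induct) (auto simp: partial_deriv_add)

lemma partial_deriv_single:
  "partial_deriv j (single \<alpha> a) = single (\<alpha> - single j 1) (of_nat (lookup \<alpha> j) * a)"
  by (cases "a = 0") (simp_all add: partial_deriv_def)

lemma partial_deriv_mult:
  "partial_deriv j (F * G) = partial_deriv j F * G + F * partial_deriv j G"
proof (induction F rule: poly_mapping_additive_induct)
  case (single \<alpha> a)
  show ?case
  proof (induction G rule: poly_mapping_additive_induct)
    case (single \<beta> b)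
    \<comment> \<open>If \<open>lookup \<alpha> j = 0\<close>, the two exponents may differ because
      of truncation, but the coefficient on both sides is 0.\<close>
    have 1: "single (\<alpha> + \<beta> - single j 1) (of_nat (lookup \<alpha> j) * a * b) =
        single (\<alpha> - single j 1 + \<beta>) (of_nat (lookup \<alpha> j) * a * b)"
    proof (cases "lookup \<alpha> j = 0")
      case False
      then obtain \<gamma> where \<gamma>: "\<alpha> = \<gamma> + single j 1"
        using exponent_minus_iff[of "\<alpha> - single j 1" \<alpha> j] that by auto
      have "\<alpha> + \<beta> = \<gamma> + \<beta> + single j 1"
        unfolding \<gamma> by (simp only: ac_simps)
      then have "\<alpha> + \<beta> - single j 1 = \<alpha> - single j 1 + \<beta>"
        unfolding \<gamma> by (simp only: add_diff_cancel_right')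
      then show ?thesis by simp
    qed simp
    have 2: "single (\<alpha> + \<beta> - single j 1) (of_nat (lookup \<beta> j) * (a * b)) =
        single (\<alpha> + (\<beta> - single j 1)) (of_nat (lookup \<beta> j) * (a * b))"
    proof (cases "lookup \<beta> j = 0")
      case False
      then obtain \<gamma> where \<gamma>: "\<beta> = \<gamma> + single j 1"
        using exponent_minus_iff[of "\<beta> - single j 1" \<beta> j] that by auto
      then have "\<alpha> + \<beta> - single j 1 = \<alpha> + (\<beta> - single j 1)"
        by (metis add.assoc add_diff_cancel_right')
      then show ?thesis by simp
    qed simp
    have 3: "a * (of_nat (lookup \<beta> j) * b) = of_nat (lookup \<beta> j) * (a * b)"
      by (metis mult.assoc mult_of_nat_commute)
    have "partial_deriv j (single \<alpha> a * single \<beta> b) =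
        single (\<alpha> + \<beta> - single j 1) (of_nat (lookup \<alpha> j) * a * b)
        + single (\<alpha> + \<beta> - single j 1) (of_nat (lookup \<beta> j) * (a * b))"
      by (simp only: mult_single partial_deriv_single lookup_add of_nat_add distrib_right
          mult.assoc single_add)
    then have "partial_deriv j (single \<alpha> a * single \<beta> b) =
        single (\<alpha> - single j 1 + \<beta>) (of_nat (lookup \<alpha> j) * a * b)
        + single (\<alpha> + (\<beta> - single j 1)) (of_nat (lookup \<beta> j) * (a * b))"
      unfolding 1 2 .
    then show ?case
      by (simp only: mult_single partial_deriv_single 3)
  next
    case (add G H)
    then show ?case
      by (simp only: partial_deriv_add distrib_left distrib_right ac_simps)
  qed simp
next
  case (add F H)
  then show ?case
    by (simp only: partial_deriv_add distrib_left distrib_right ac_simps)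
qed simp

lemma partial_deriv_const [simp]: "partial_deriv j (poly_const a) = 0"
  by (simp add: partial_deriv_single)

lemma partial_deriv_var: "partial_deriv i (var j) = (if i = j then 1 else 0)"
  by (auto simp: var_def partial_deriv_single lookup_single when_def)

lemma partial_deriv_scale: "partial_deriv j (poly_scale c F) = poly_scale c (partial_deriv j F)"
  by (simp add: poly_scale_def partial_deriv_mult)

section \<open>The Euler operator and the anticommutator of \<open>x\<close> with the Dirac
  operator\<close>

definition euler :: "nat set \<Rightarrow> clifford_poly \<Rightarrow> clifford_poly" where
  "euler I F = (\<Sum>j\<in>I. var j * partial_deriv j F)"

lemma euler_mult: "euler I (F * G) = euler I F * G + F * euler I G"
proof -
  have "var j * (F * D) = F * (var j * D)" for j D
    by (metis mult.assoc var_commute)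
  then show ?thesis
    by (simp add: euler_def partial_deriv_mult distrib_left sum.distrib sum_distrib_left
        sum_distrib_right mult.assoc)
qed

lemma dirac_add: "dirac I (F + G) = dirac I F + dirac I G"
  by (simp add: dirac_def partial_deriv_add distrib_left sum.distrib)

lemma dirac_0 [simp]: "dirac I 0 = 0"
  by (simp add: dirac_def)

lemma dirac_minus: "dirac I (- F) = - dirac I F"
  by (simp add: dirac_def partial_deriv_minus sum_negf)

lemma dirac_diff: "dirac I (F - G) = dirac I F - dirac I G"
  using dirac_add[of I F "- G"] by (simp add: dirac_minus)

lemma dirac_scale: "dirac I (poly_scale c F) = poly_scale c (dirac I F)"
  by (simp add: dirac_def partial_deriv_scale poly_scale_mult_right cpoly.scale_sum_right)

lemma euler_vec_var:
  assumes "finite I"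
  shows "euler I (vec_var I) = vec_var I"
proof -
  have "euler I (vec_var I) = (\<Sum>i\<in>I. \<Sum>j\<in>I. if i = j then pgen j * var j else 0)"
    unfolding euler_def vec_var_altdef partial_deriv_sum sum_distrib_left
    by (intro sum.cong refl) (simp add: partial_deriv_mult partial_deriv_var var_commute)
  also have "\<dots> = vec_var I"
    using assms by (simp add: vec_var_altdef)
  finally show ?thesis .
qed

text \<open>This is the \<open>osp(1|2)\<close> relation: the anticommutator of \<open>x\<close> and
  the Dirac operator is minus twice the Euler operator minus the dimension. Pairs of distinct
  generators anticommute, and the diagonal pairs produce the two extra terms.\<close>

lemma dirac_vec_var_mult:
  assumes "finite I"
  shows "dirac I (vec_var I * F) =
    - (vec_var I * dirac I F) - 2 * euler I F - of_nat (card I) * F"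
proof -
  have "dirac I (vec_var I * F) = (\<Sum>i\<in>I. \<Sum>j\<in>I. pgen i * (pgen j *
      ((if i = j then F else 0) + var j * partial_deriv i F)))"
    unfolding dirac_def vec_var_mult partial_deriv_sum sum_distrib_left
    by (intro sum.cong refl) (simp add: partial_deriv_mult partial_deriv_var)
  \<comment> \<open>The diagonal carries the factor 2 to compensate for its share of the subtracted
    sum. The latter then runs over all pairs and equals
    \<open>vec_var I * dirac I F\<close>.\<close>
  also have "\<dots> = (\<Sum>i\<in>I. \<Sum>j\<in>I. (if i = j then - F - 2 * (var j * partial_deriv i F) else 0)
      - pgen j * (var j * (pgen i * partial_deriv i F)))"
  proof (intro sum.cong refl)
    fix i j
    have sq: "pgen i * (pgen i * G) = - G" for G
    proof -
      have "pgen i * pgen i = - 1"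
        using gen_square[of i] by (simp add: mult_single single_uminus)
      then show ?thesis
        by (metis mult.assoc mult_minus1)
    qed
    have "pgen i * (var j * G) = var j * (pgen i * G)" for G
      by (metis mult.assoc var_commute)
    then show "pgen i * (pgen j * ((if i = j then F else 0) + var j * partial_deriv i F)) =
        (if i = j then - F - 2 * (var j * partial_deriv i F) else 0)
      - pgen j * (var j * (pgen i * partial_deriv i F))"
      using pgen_relation[of i j "var j * partial_deriv i F"] sq
      by (auto simp: distrib_left)
  qed
  also have "\<dots> = (\<Sum>i\<in>I. - F - 2 * (var i * partial_deriv i F)) - vec_var I * dirac I F"
    using assms sum.swap[of "\<lambda>i j. pgen j * (var j * (pgen i * partial_deriv i F))" I I]
    by (simp add: sum_subtractf vec_var_mult dirac_def sum_distrib_left)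
  also have "\<dots> = - (vec_var I * dirac I F) - 2 * euler I F - of_nat (card I) * F"
    by (simp add: sum_subtractf sum_negf euler_def sum_distrib_left)
  finally show ?thesis .
qed

text \<open>No derivative in \<open>I\<close> hits a variable of \<open>K\<close>, and every
  generator of \<open>I\<close> anticommutes with every generator of \<open>K\<close>.\<close>

lemma dirac_vec_var_mult_disjoint:
  assumes "I \<inter> K = {}"
  shows "dirac I (vec_var K * F) = - (vec_var K * dirac I F)"
proof -
  have "dirac I (vec_var K * F) = (\<Sum>i\<in>I. \<Sum>j\<in>K. pgen i * (pgen j * (var j * partial_deriv i F)))"
    unfolding dirac_def vec_var_mult partial_deriv_sum sum_distrib_left
    by (intro sum.cong refl) (use assms in \<open>auto simp: partial_deriv_mult partial_deriv_var\<close>)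
  also have "\<dots> = (\<Sum>i\<in>I. \<Sum>j\<in>K. - (pgen j * (var j * (pgen i * partial_deriv i F))))"
  proof (intro sum.cong refl)
    fix i j assume "i \<in> I" "j \<in> K"
    then have "i \<noteq> j"
      using assms by auto
    moreover have "pgen i * (var j * G) = var j * (pgen i * G)" for G
      by (metis mult.assoc var_commute)
    ultimately show "pgen i * (pgen j * (var j * partial_deriv i F)) =
        - (pgen j * (var j * (pgen i * partial_deriv i F)))"
      using pgen_relation[of i j "var j * partial_deriv i F"] by simp
  qed
  also have "\<dots> = - (vec_var K * dirac I F)"
    by (simp add: vec_var_mult dirac_def sum_distrib_left sum_negf sum.swap[of _ K I])
  finally show ?thesis .
qed


section \<open>The Fischer inner product\<close>

lemma clifford_of_nat: "of_nat n = clifford_const (of_nat n)"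
  by (induction n) (simp_all add: clifford_const_add)

lemma scalar_part_simps [simp]:
  "scalar_part 0 = 0" "scalar_part (a + b) = scalar_part a + scalar_part b"
  "scalar_part (- a) = - scalar_part a" "scalar_part (clifford_const c * a) = c * scalar_part a"
  "scalar_part (of_nat n * a) = of_nat n * scalar_part a"
  by (simp_all add: scalar_part_def clifford_of_nat)

text \<open>A product of two blades has a scalar part only if the blades coincide, and the square of
  the blade of \<open>A\<close> is \<open>blade_sign A A\<close>. The free index set
  \<open>S\<close> allows one sum to serve several factors.\<close>

lemma scalar_part_times:
  assumes "finite S" "{A. blade_coeff a A \<noteq> 0} \<subseteq> S"
  shows "scalar_part (a * b) = (\<Sum>A\<in>S. blade_sign A A * blade_coeff a A * blade_coeff b A)"
proof -
  obtain N where N: "finite N" "{A. blade_coeff a A \<noteq> 0} \<subseteq> Pow N"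
    by (rule common_blade_bound[of a a a]) blast
  have "scalar_part (a * b) = (\<Sum>A\<in>Pow N. blade_sign A A * blade_coeff a A * blade_coeff b A)"
    by (simp add: scalar_part_def blade_coeff_times[OF N])
  also have "\<dots> = (\<Sum>A | blade_coeff a A \<noteq> 0. blade_sign A A * blade_coeff a A * blade_coeff b A)"
    by (rule sum.mono_neutral_right) (use N in auto)
  also have "\<dots> = (\<Sum>A\<in>S. blade_sign A A * blade_coeff a A * blade_coeff b A)"
    by (rule sum.mono_neutral_left) (use assms in auto)
  finally show ?thesis .
qed

lemma scalar_part_commute: "scalar_part (a * b) = scalar_part (b * a)"
proof -
  define S where "S = {A. blade_coeff a A \<noteq> 0} \<union> {A. blade_coeff b A \<noteq> 0}"
  have "finite S" "{A. blade_coeff a A \<noteq> 0} \<subseteq> S" "{A. blade_coeff b A \<noteq> 0} \<subseteq> S"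
    by (auto simp: S_def)
  then show ?thesis
    by (simp add: scalar_part_times[of S] mult_ac)
qed

text \<open>The empty blade is the only one common to the two subalgebras, so a single summand
  survives.\<close>

lemma scalar_part_times_disjoint:
  assumes "a \<in> clifford_alg I" "b \<in> clifford_alg K" "I \<inter> K = {}"
  shows "scalar_part (a * b) = scalar_part a * scalar_part b"
proof -
  define S where "S = insert {} {A. blade_coeff a A \<noteq> 0}"
  have "scalar_part (a * b) = (\<Sum>A\<in>S. blade_sign A A * blade_coeff a A * blade_coeff b A)"
    by (rule scalar_part_times) (auto simp: S_def)
  also have "\<dots> = (\<Sum>A\<in>S. if A = {} then blade_coeff a A * blade_coeff b A else 0)"
  proof (intro sum.cong refl)
    fix A
    have "blade_coeff a A * blade_coeff b A = 0" if "A \<noteq> {}"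
    proof (rule ccontr)
      assume "blade_coeff a A * blade_coeff b A \<noteq> 0"
      then have "A \<subseteq> I" "A \<subseteq> K"
        using assms(1,2) by (simp_all add: clifford_alg_eq)
      then show False
        using assms(3) \<open>A \<noteq> {}\<close> by blast
    qed
    then show "blade_sign A A * blade_coeff a A * blade_coeff b A =
        (if A = {} then blade_coeff a A * blade_coeff b A else 0)"
      by auto
  qed
  also have "\<dots> = scalar_part a * scalar_part b"
    by (simp add: S_def scalar_part_def)
  finally show ?thesis .
qed

text \<open>The sign in the conjugation cancels the sign of the squared blade, which leaves the
  standard Hermitian product of the coordinates.\<close>

lemma scalar_part_conj_times:
  assumes "finite S" "{A. blade_coeff a A \<noteq> 0} \<subseteq> S"
  shows "scalar_part (clifford_conj a * b) = (\<Sum>A\<in>S. cnj (blade_coeff a A) * blade_coeff b A)"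
proof -
  have "scalar_part (clifford_conj a * b) =
      (\<Sum>A\<in>S. blade_sign A A * blade_coeff (clifford_conj a) A * blade_coeff b A)"
    by (rule scalar_part_times) (use assms in auto)
  then show ?thesis
    by (simp flip: mult.assoc)
qed

lemma scalar_part_conj_times_cnj:
  "cnj (scalar_part (clifford_conj a * b)) = scalar_part (clifford_conj b * a)"
proof -
  define S where "S = {A. blade_coeff a A \<noteq> 0} \<union> {A. blade_coeff b A \<noteq> 0}"
  have "finite S" "{A. blade_coeff a A \<noteq> 0} \<subseteq> S" "{A. blade_coeff b A \<noteq> 0} \<subseteq> S"
    by (auto simp: S_def)
  then show ?thesis
    by (simp add: scalar_part_conj_times[of S] mult_ac)
qed

lemma scalar_part_conj_self:
  "\<exists>r\<ge>0. scalar_part (clifford_conj a * a) = complex_of_real r \<and> (r = 0 \<longrightarrow> a = 0)"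
proof (intro exI conjI impI)
  let ?r = "\<Sum>A | blade_coeff a A \<noteq> 0. (cmod (blade_coeff a A))\<^sup>2"
  show "0 \<le> ?r"
    by (intro sum_nonneg) simp
  show "scalar_part (clifford_conj a * a) = complex_of_real ?r"
    by (subst scalar_part_conj_times[OF finite_blade_support order_refl])
      (simp add: complex_norm_square mult.commute del: of_real_power)
  assume "?r = 0"
  then have "\<forall>A\<in>{A. blade_coeff a A \<noteq> 0}. (cmod (blade_coeff a A))\<^sup>2 = 0"
    by (subst (asm) sum_nonneg_eq_0_iff) auto
  then show "a = 0"
    by (intro clifford_eqI) auto
qed

lemma clifford_conj_0 [simp]: "clifford_conj 0 = 0"
  by (rule clifford_eqI) simp

section \<open>Factorial weights and the coordinate formula for the Fischer inner product\<close>

definition exponent_fact :: "(nat \<Rightarrow>\<^sub>0 nat) \<Rightarrow> nat" where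
  "exponent_fact \<alpha> = (\<Prod>j\<in>keys \<alpha>. fact (lookup \<alpha> j))"

lemma exponent_fact_pos: "exponent_fact \<alpha> > 0"
  by (simp add: exponent_fact_def prod_pos)

lemma exponent_fact_superset:
  assumes "finite S" "keys \<alpha> \<subseteq> S"
  shows "exponent_fact \<alpha> = (\<Prod>j\<in>S. fact (lookup \<alpha> j))"
  unfolding exponent_fact_def
  by (rule prod.mono_neutral_left) (use assms in \<open>auto simp: in_keys_iff\<close>)

text \<open>The ratio of the two weights is the factor produced by differentiating once; this makes
  multiplication by a variable adjoint to the partial derivative.\<close>

lemma exponent_fact_add_single:
  "exponent_fact (\<alpha> + single j 1) = (lookup \<alpha> j + 1) * exponent_fact \<alpha>"
proof -
  define S where "S = keys \<alpha> - {j}"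
  have S: "finite S" "j \<notin> S"
    by (auto simp: S_def)
  have "exponent_fact (\<alpha> + single j 1) = (\<Prod>i\<in>insert j S. fact (lookup (\<alpha> + single j 1) i))"
    by (rule exponent_fact_superset)
      (auto simp: S_def in_keys_iff lookup_add lookup_single when_def split: if_splits)
  also have "\<dots> = fact (lookup \<alpha> j + 1) * (\<Prod>i\<in>S. fact (lookup \<alpha> i))"
  proof -
    have "(\<Prod>i\<in>S. fact (lookup (\<alpha> + single j 1) i)) = (\<Prod>i\<in>S. fact (lookup \<alpha> i) :: nat)"
      by (intro prod.cong refl) (auto simp: S_def lookup_add lookup_single when_def)
    then show ?thesis
      using S by (simp add: lookup_add)
  qed
  also have "\<dots> = (lookup \<alpha> j + 1) * (\<Prod>i\<in>insert j S. fact (lookup \<alpha> i))"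
    using S by (simp add: algebra_simps)
  also have "(\<Prod>i\<in>insert j S. fact (lookup \<alpha> i)) = exponent_fact \<alpha>"
    by (rule exponent_fact_superset[symmetric]) (auto simp: S_def)
  finally show ?thesis .
qed

lemma exponent_fact_add_disjoint:
  assumes "keys \<alpha> \<inter> keys \<beta> = {}"
  shows "exponent_fact (\<alpha> + \<beta>) = exponent_fact \<alpha> * exponent_fact \<beta>"
proof -
  have "exponent_fact (\<alpha> + \<beta>) = (\<Prod>j\<in>keys \<alpha> \<union> keys \<beta>. fact (lookup (\<alpha> + \<beta>) j))"
    by (rule exponent_fact_superset) (auto simp: keys_add)
  also have "\<dots> = (\<Prod>j\<in>keys \<alpha>. fact (lookup (\<alpha> + \<beta>) j)) * (\<Prod>j\<in>keys \<beta>. fact (lookup (\<alpha> + \<beta>) j))"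
    using assms by (intro prod.union_disjoint) auto
  also have "(\<Prod>j\<in>keys \<alpha>. fact (lookup (\<alpha> + \<beta>) j)) = exponent_fact \<alpha>"
    unfolding exponent_fact_def
    by (intro prod.cong refl)
      (use assms in \<open>metis disjoint_iff in_keys_iff lookup_add add.right_neutral\<close>)
  also have "(\<Prod>j\<in>keys \<beta>. fact (lookup (\<alpha> + \<beta>) j)) = exponent_fact \<beta>"
    unfolding exponent_fact_def
    by (intro prod.cong refl)
      (use assms in \<open>metis disjoint_iff in_keys_iff lookup_add add.left_neutral\<close>)
  finally show ?thesis .
qed

lemma lookup_partial_deriv_funpow:
  "lookup ((partial_deriv j ^^ n) F) \<beta> =
    of_nat (pochhammer (lookup \<beta> j + 1) n) * lookup F (\<beta> + single j n)"
proof (induction n arbitrary: F)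
  case (Suc n)
  have "lookup ((partial_deriv j ^^ Suc n) F) \<beta> =
      of_nat (pochhammer (lookup \<beta> j + 1) n) * lookup (partial_deriv j F) (\<beta> + single j n)"
    by (simp only: funpow_Suc_right o_apply Suc)
  also have "\<dots> = of_nat (pochhammer (lookup \<beta> j + 1) n * (lookup \<beta> j + n + 1)) *
      lookup F (\<beta> + (single j n + single j 1))"
    by (simp only: lookup_partial_deriv lookup_add lookup_single_eq add.assoc mult.assoc of_nat_mult)
  also have "pochhammer (lookup \<beta> j + 1) n * (lookup \<beta> j + n + 1) = pochhammer (lookup \<beta> j + 1) (Suc n)"
    by (simp add: pochhammer_Suc)
  also have "single j n + single j 1 = single j (Suc n)"
    by (simp flip: single_add)
  finally show ?case .
qed simp

lemma lookup_multi_deriv_0: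
  "lookup (multi_deriv \<alpha> F) 0 = of_nat (exponent_fact \<alpha>) * lookup F \<alpha>"
proof -
  \<comment> \<open>Generalised from the sorted list of keys to any distinct list, and from 0 to
    exponents vanishing on that list. The vanishing makes each Pochhammer symbol start at 1, so that
    it is a factorial.\<close>
  have *: "lookup (foldr (\<lambda>j. partial_deriv j ^^ lookup \<alpha> j) xs F) \<beta> =
      of_nat (\<Prod>j\<in>set xs. fact (lookup \<alpha> j)) * lookup F (\<beta> + (\<Sum>j\<in>set xs. single j (lookup \<alpha> j)))"
    if "distinct xs" "\<And>j. j \<in> set xs \<Longrightarrow> lookup \<beta> j = 0" for xs \<beta>
    using that
  proof (induction xs arbitrary: \<beta>)
    case (Cons j xs)
    have "lookup (foldr (\<lambda>j. partial_deriv j ^^ lookup \<alpha> j) xs F) (\<beta> + single j (lookup \<alpha> j)) =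
        of_nat (\<Prod>j\<in>set xs. fact (lookup \<alpha> j)) *
        lookup F (\<beta> + single j (lookup \<alpha> j) + (\<Sum>j\<in>set xs. single j (lookup \<alpha> j)))"
      using Cons.prems by (intro Cons.IH) (auto simp: lookup_add lookup_single when_def)
    moreover have "pochhammer (Suc 0) n = fact n" for n
      using pochhammer_fact[of n, where 'a = nat] by simp
    ultimately show ?case
      using Cons.prems
      by (simp add: lookup_partial_deriv_funpow add.assoc mult.assoc)
  qed simp
  have "lookup (multi_deriv \<alpha> F) 0 = of_nat (\<Prod>j\<in>keys \<alpha>. fact (lookup \<alpha> j)) *
      lookup F (\<Sum>j\<in>keys \<alpha>. single j (lookup \<alpha> j))"
    unfolding multi_deriv_def by (subst *) auto
  then show ?thesis
    by (simp only: exponent_fact_def poly_mapping_sum_single[symmetric])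
qed

text \<open>Evaluation at 0 leaves one coefficient of \<open>Q\<close> for each monomial of
  \<open>P\<close>. Enlarging the index set to \<open>S\<close> gives a common range of summation
  for different left arguments.\<close>

lemma fischer_inner_superset:
  assumes "finite S" "keys P \<subseteq> S"
  shows "fischer_inner P Q = (\<Sum>\<alpha>\<in>S. of_nat (exponent_fact \<alpha>) *
    scalar_part (clifford_conj (lookup P \<alpha>) * lookup Q \<alpha>))"
proof -
  have "scalar_part (sum f S) = (\<Sum>x\<in>S. scalar_part (f x))" for f :: "(nat \<Rightarrow>\<^sub>0 nat) \<Rightarrow> clifford" and S
    by (induction S rule: infinite_finite_induct) auto
  moreover have "a * (of_nat n * b) = of_nat n * (a * b)" for a b :: clifford and n
    by (metis mult.assoc mult_of_nat_commute)
  ultimately have "fischer_inner P Q = (\<Sum>\<alpha>\<in>keys P. of_nat (exponent_fact \<alpha>) *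
      scalar_part (clifford_conj (lookup P \<alpha>) * lookup Q \<alpha>))"
    by (simp add: fischer_inner_def conj_diff_op_def lookup_sum lookup_const_mult
        lookup_multi_deriv_0)
  also have "\<dots> = (\<Sum>\<alpha>\<in>S. of_nat (exponent_fact \<alpha>) *
    scalar_part (clifford_conj (lookup P \<alpha>) * lookup Q \<alpha>))"
    by (rule sum.mono_neutral_left) (use assms in \<open>auto simp: in_keys_iff\<close>)
  finally show ?thesis .
qed

lemma fischer_inner_add_right: "fischer_inner P (Q + R) = fischer_inner P Q + fischer_inner P R"
  by (simp add: fischer_inner_superset[OF finite_keys order_refl] lookup_add distrib_left sum.distrib)

lemma fischer_inner_add_left: "fischer_inner (P + Q) R = fischer_inner P R + fischer_inner Q R"
proof -
  define S where "S = keys P \<union> keys Q"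
  have "finite S" "keys P \<subseteq> S" "keys Q \<subseteq> S" "keys (P + Q) \<subseteq> S"
    using keys_add[of P Q] by (auto simp: S_def)
  then show ?thesis
    by (simp add: fischer_inner_superset[of S] lookup_add clifford_conj_add distrib_left
        distrib_right sum.distrib)
qed

lemma fischer_inner_0 [simp]: "fischer_inner P 0 = 0" "fischer_inner 0 P = 0"
  by (simp_all add: fischer_inner_superset[OF finite_keys order_refl])

lemma fischer_inner_scale_right: "fischer_inner P (poly_scale c Q) = c * fischer_inner P Q"
proof -
  have "a * (clifford_const c * b) = clifford_const c * (a * b)" for a b
    by (metis mult.assoc clifford_const_commute)
  then show ?thesis
    by (simp add: fischer_inner_superset[OF finite_keys order_refl] sum_distrib_left mult_ac)
qed

lemma fischer_inner_cnj: "cnj (fischer_inner P Q) = fischer_inner Q P"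
proof -
  define S where "S = keys P \<union> keys Q"
  have "finite S" "keys P \<subseteq> S" "keys Q \<subseteq> S"
    by (auto simp: S_def)
  then show ?thesis
    by (simp add: fischer_inner_superset[of S] scalar_part_conj_times_cnj)
qed

lemma fischer_inner_scale_left: "fischer_inner (poly_scale c P) Q = cnj c * fischer_inner P Q"
  by (metis fischer_inner_cnj fischer_inner_scale_right complex_cnj_mult)

lemma fischer_inner_sum_left: "fischer_inner (sum f S) Q = (\<Sum>x\<in>S. fischer_inner (f x) Q)"
  by (induction S rule: infinite_finite_induct) (auto simp: fischer_inner_add_left)

lemma fischer_inner_sum_right: "fischer_inner Q (sum f S) = (\<Sum>x\<in>S. fischer_inner Q (f x))"
  by (induction S rule: infinite_finite_induct) (auto simp: fischer_inner_add_right)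

lemma fischer_inner_single:
  "fischer_inner (single \<alpha> a) Q =
    of_nat (exponent_fact \<alpha>) * scalar_part (clifford_conj a * lookup Q \<alpha>)"
  by (subst fischer_inner_superset[of "{\<alpha>}"]) auto

text \<open>The coordinate formula writes the value as a sum of nonnegative reals with positive
  weights, so every coefficient has norm 0.\<close>

lemma fischer_inner_self_eq_0:
  assumes "fischer_inner F F = 0"
  shows "F = 0"
proof -
  obtain r where r: "\<And>\<alpha>. r \<alpha> \<ge> 0" "\<And>\<alpha>. lookup F \<alpha> \<noteq> 0 \<Longrightarrow> r \<alpha> \<noteq> 0"
    "\<And>\<alpha>. scalar_part (clifford_conj (lookup F \<alpha>) * lookup F \<alpha>) = complex_of_real (r \<alpha>)"
  proof -
    have "\<exists>r. \<forall>\<alpha>. r \<alpha> \<ge> 0 \<and> (lookup F \<alpha> \<noteq> 0 \<longrightarrow> r \<alpha> \<noteq> 0) \<and>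
        scalar_part (clifford_conj (lookup F \<alpha>) * lookup F \<alpha>) = complex_of_real (r \<alpha>)"
      by (intro choice allI) (use scalar_part_conj_self in blast)
    then show ?thesis
      using that by blast
  qed
  have "complex_of_real (\<Sum>\<alpha>\<in>keys F. real (exponent_fact \<alpha>) * r \<alpha>) = 0"
    using assms by (simp add: fischer_inner_superset[OF finite_keys order_refl] r(3))
  then have "(\<Sum>\<alpha>\<in>keys F. real (exponent_fact \<alpha>) * r \<alpha>) = 0"
    using of_real_eq_0_iff by blast
  then have "\<forall>\<alpha>\<in>keys F. real (exponent_fact \<alpha>) * r \<alpha> = 0"
    by (subst (asm) sum_nonneg_eq_0_iff) (auto simp: r(1))
  then have "\<forall>\<alpha>\<in>keys F. r \<alpha> = 0"
    using exponent_fact_pos by (metis mult_eq_0_iff of_nat_0_eq_iff less_irrefl)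
  then have "lookup F \<alpha> = 0" for \<alpha>
    using r(2) by (metis in_keys_iff)
  then show ?thesis
    by (intro poly_mapping_eqI) simp
qed

section \<open>Adjoints of the multiplication operators\<close>

lemma fischer_inner_var_left: "fischer_inner (var j * P) Q = fischer_inner P (partial_deriv j Q)"
proof (induction P rule: poly_mapping_additive_induct)
  case (single \<alpha> a)
  have "clifford_conj a * (of_nat n * b) = of_nat n * (clifford_conj a * b)" for n b
    by (metis mult.assoc mult_of_nat_commute)
  then show ?case
    by (simp only: var_def mult_single fischer_inner_single lookup_partial_deriv
        add.commute[of "single j 1"] exponent_fact_add_single mult_1_left of_nat_mult
        scalar_part_simps mult_ac)
qed (simp_all add: distrib_left fischer_inner_add_left)

lemma fischer_inner_pgen_left: "fischer_inner (pgen j * P) Q = - fischer_inner P (pgen j * Q)"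
  by (induction P rule: poly_mapping_additive_induct)
    (simp_all add: mult_single fischer_inner_single lookup_const_mult distrib_left
      fischer_inner_add_left clifford_conj_mult clifford_conj_gen mult.assoc)

text \<open>Variables are adjoint to derivatives, and generators are skew-adjoint because
  conjugation negates them; the second fact gives the sign.\<close>

lemma fischer_inner_vec_var_left:
  "fischer_inner (vec_var I * P) Q = - fischer_inner P (dirac I Q)"
  unfolding vec_var_mult dirac_def fischer_inner_sum_left fischer_inner_sum_right
    sum_negf[symmetric]
proof (intro sum.cong refl)
  fix j
  have "partial_deriv j (pgen j * Q) = pgen j * partial_deriv j Q"
    by (simp add: partial_deriv_mult)
  then show "fischer_inner (pgen j * (var j * P)) Q = - fischer_inner P (pgen j * partial_deriv j Q)"
    by (simp add: fischer_inner_pgen_left fischer_inner_var_left)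
qed

lemma fischer_inner_vec_var_right:
  "fischer_inner P (vec_var I * Q) = - fischer_inner (dirac I P) Q"
  by (metis fischer_inner_cnj fischer_inner_vec_var_left complex_cnj_minus)

lemma fischer_inner_vec_var_power_right:
  "fischer_inner P (vec_var I ^ s * Q) = (- 1) ^ s * fischer_inner ((dirac I ^^ s) P) Q"
proof (induction s arbitrary: Q)
  case (Suc s)
  have "fischer_inner P (vec_var I ^ Suc s * Q) = fischer_inner P (vec_var I ^ s * (vec_var I * Q))"
    by (simp only: power_Suc2 mult.assoc)
  then show ?case
    by (simp add: Suc fischer_inner_vec_var_right)
qed simp

text \<open>Multiples of \<open>x\<close> are orthogonal to monogenic polynomials, so
  \<open>F\<close> is orthogonal to itself. This is the source of uniqueness in the Fischer
  decomposition.\<close>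

lemma vec_var_mult_monogenic_eq_0:
  assumes "F = vec_var I * H" "dirac I F = 0"
  shows "F = 0"
proof (rule fischer_inner_self_eq_0)
  have "fischer_inner F F = - fischer_inner H (dirac I F)"
    by (subst (1) assms(1)) (rule fischer_inner_vec_var_left)
  then show "fischer_inner F F = 0"
    by (simp add: assms(2))
qed


section \<open>Homogeneous polynomials\<close>

definition total_degree :: "(nat \<Rightarrow>\<^sub>0 nat) \<Rightarrow> nat" where
  "total_degree \<alpha> = (\<Sum>j\<in>keys \<alpha>. lookup \<alpha> j)"

lemma total_degree_superset:
  "finite S \<Longrightarrow> keys \<alpha> \<subseteq> S \<Longrightarrow> total_degree \<alpha> = (\<Sum>j\<in>S. lookup \<alpha> j)"
  unfolding total_degree_def by (rule sum.mono_neutral_left) (auto simp: in_keys_iff)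

lemma total_degree_add: "total_degree (\<alpha> + \<beta>) = total_degree \<alpha> + total_degree \<beta>"
proof -
  have "finite (keys \<alpha> \<union> keys \<beta>)" "keys (\<alpha> + \<beta>) \<subseteq> keys \<alpha> \<union> keys \<beta>"
    using keys_add[of \<alpha> \<beta>] by auto
  then show ?thesis
    by (simp add: total_degree_superset[of "keys \<alpha> \<union> keys \<beta>"] lookup_add sum.distrib)
qed

lemma total_degree_single [simp]: "total_degree (single j n) = n"
  by (simp add: total_degree_def)

text \<open>The decomposition is carried out degree by degree, since the Euler operator acts on each
  of these spaces as a scalar.\<close>

definition hpolys :: "nat set \<Rightarrow> nat \<Rightarrow> clifford_poly set" where
  "hpolys I k = {F \<in> clifford_polys I. homogeneous k F}"

lemma hpolys_iff:
  "F \<in> hpolys I k \<longleftrightarrow> (\<forall>\<alpha>. lookup F \<alpha> \<noteq> 0 \<longrightarrow>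
     keys \<alpha> \<subseteq> I \<and> lookup F \<alpha> \<in> clifford_alg I \<and> total_degree \<alpha> = k)"
  by (auto simp: hpolys_def clifford_polys_def homogeneous_def total_degree_def in_keys_iff)

lemma homogeneous_monogenics_iff:
  "F \<in> homogeneous_monogenics I k \<longleftrightarrow> F \<in> hpolys I k \<and> dirac I F = 0"
  by (auto simp: homogeneous_monogenics_def monogenics_def hpolys_def)

lemma homogeneous_monogenics_subset: "homogeneous_monogenics I k \<subseteq> monogenics I"
  by (auto simp: homogeneous_monogenics_def)

lemma clifford_alg_of_nat_mult: "a \<in> clifford_alg I \<Longrightarrow> of_nat n * a \<in> clifford_alg I"
  by (simp add: clifford_of_nat clifford_alg.intros)

lemma clifford_alg_mono: "I \<subseteq> J \<Longrightarrow> clifford_alg I \<subseteq> clifford_alg J"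
  by (auto simp: clifford_alg_eq)

lemma hpolys_mono: "I \<subseteq> J \<Longrightarrow> hpolys I k \<subseteq> hpolys J k"
  using clifford_alg_mono[of I J] unfolding hpolys_iff subset_iff by blast

lemma subspace_hpolys: "cpoly.subspace (hpolys I k)"
  unfolding cpoly.subspace_def
proof (intro conjI allI ballI)
  show "0 \<in> hpolys I k"
    by (simp add: hpolys_iff)
next
  fix F G assume "F \<in> hpolys I k" "G \<in> hpolys I k"
  then show "F + G \<in> hpolys I k"
    unfolding hpolys_iff lookup_add
    by (metis add.right_neutral add.left_neutral clifford_alg.add)
next
  fix c F assume "F \<in> hpolys I k"
  then show "poly_scale c F \<in> hpolys I k"
    unfolding hpolys_iff lookup_poly_scale by (metis mult_zero_right clifford_alg.intros(1,4))
qed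

lemmas hpolys_0 = cpoly.subspace_0[OF subspace_hpolys]
  and hpolys_add = cpoly.subspace_add[OF subspace_hpolys]
  and hpolys_scale = cpoly.subspace_scale[OF subspace_hpolys]
  and hpolys_sum = cpoly.subspace_sum[OF subspace_hpolys]

lemma hpolys_single:
  "keys \<alpha> \<subseteq> I \<Longrightarrow> a \<in> clifford_alg I \<Longrightarrow> total_degree \<alpha> = k \<Longrightarrow> single \<alpha> a \<in> hpolys I k"
  by (auto simp: hpolys_iff lookup_single when_def)

lemma hpolys_induct [consumes 1, case_names zero single add]:
  assumes "F \<in> hpolys I k" "P 0"
    "\<And>\<alpha> a. keys \<alpha> \<subseteq> I \<Longrightarrow> a \<in> clifford_alg I \<Longrightarrow> total_degree \<alpha> = k \<Longrightarrow> P (single \<alpha> a)"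
    "\<And>F G. P F \<Longrightarrow> P G \<Longrightarrow> P (F + G)"
  shows "P F"
proof -
  have "P (\<Sum>\<alpha>\<in>S. single \<alpha> (lookup F \<alpha>))" if "finite S" "S \<subseteq> keys F" for S
    using that
    by induction (use assms in \<open>auto simp: hpolys_iff in_keys_iff\<close>)
  from this[OF finite_keys order_refl] show ?thesis
    using arg_cong[OF poly_mapping_sum_single, of P F] by iprover
qed

lemma hpolys_mult:
  assumes "F \<in> hpolys I k" "G \<in> hpolys I l"
  shows "F * G \<in> hpolys I (k + l)"
  using assms(1)
proof (induction rule: hpolys_induct)
  case (single \<alpha> a)
  note \<alpha> = this
  from assms(2) show ?case
  proof (induction rule: hpolys_induct)
    case (single \<beta> b)
    then show ?case
      using \<alpha> keys_add[of \<alpha> \<beta>]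
      by (auto simp: mult_single total_degree_add intro!: hpolys_single clifford_alg.mult)
  qed (simp_all add: hpolys_0 distrib_left hpolys_add)
qed (simp_all add: hpolys_0 distrib_right hpolys_add)

lemma vec_var_in_hpolys: "vec_var I \<in> hpolys I 1"
  unfolding vec_var_def
  by (intro hpolys_sum hpolys_single) (auto intro: clifford_alg.gen)

lemma hpolys_vec_var_power_mult:
  assumes "J \<subseteq> I" "F \<in> hpolys I k"
  shows "vec_var J ^ s * F \<in> hpolys I (s + k)"
proof (induction s)
  case (Suc s)
  have "vec_var J \<in> hpolys I 1"
    using vec_var_in_hpolys hpolys_mono assms(1) by blast
  from hpolys_mult[OF this Suc] show ?case
    by (simp add: mult.assoc)
qed (use assms in simp)

lemma hpolys_vec_var_mult: "J \<subseteq> I \<Longrightarrow> F \<in> hpolys I k \<Longrightarrow> vec_var J * F \<in> hpolys I (Suc k)"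
  using hpolys_vec_var_power_mult[of J I F k 1] by simp

lemma hpolys_partial_deriv:
  assumes "F \<in> hpolys I (Suc k)"
  shows "partial_deriv j F \<in> hpolys I k"
  unfolding hpolys_iff
proof (intro allI impI)
  fix \<beta> assume *: "lookup (partial_deriv j F) \<beta> \<noteq> 0"
  then have "lookup F (\<beta> + single j 1) \<noteq> 0"
    by (auto simp: lookup_partial_deriv)
  then have F: "keys (\<beta> + single j 1) \<subseteq> I" "lookup F (\<beta> + single j 1) \<in> clifford_alg I"
    "total_degree (\<beta> + single j 1) = Suc k"
    using assms unfolding hpolys_iff by blast+
  have "keys \<beta> \<subseteq> keys (\<beta> + single j 1)"
    by (auto simp: in_keys_iff lookup_add)
  then show "keys \<beta> \<subseteq> I \<and> lookup (partial_deriv j F) \<beta> \<in> clifford_alg I \<and> total_degree \<beta> = k"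
    using F by (auto simp: lookup_partial_deriv total_degree_add simp del: of_nat_Suc of_nat_add
        intro!: clifford_alg_of_nat_mult)
qed

lemma partial_deriv_eq_0:
  assumes "\<And>\<alpha>. lookup F \<alpha> \<noteq> 0 \<Longrightarrow> lookup \<alpha> j = 0"
  shows "partial_deriv j F = 0"
proof (rule poly_mapping_eqI)
  fix \<beta>
  have "lookup F (\<beta> + single j 1) = 0"
    using assms[of "\<beta> + single j 1"] by (auto simp: lookup_add)
  then show "lookup (partial_deriv j F) \<beta> = lookup 0 \<beta>"
    by (simp add: lookup_partial_deriv)
qed

lemma partial_deriv_hpolys_0: "F \<in> hpolys I 0 \<Longrightarrow> partial_deriv j F = 0"
  by (rule partial_deriv_eq_0) (auto simp: hpolys_iff total_degree_def in_keys_iff)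

lemma partial_deriv_notin: "F \<in> hpolys I k \<Longrightarrow> j \<notin> I \<Longrightarrow> partial_deriv j F = 0"
  by (rule partial_deriv_eq_0) (metis hpolys_iff in_keys_iff subsetD)

lemma euler_disjoint: "F \<in> hpolys K k \<Longrightarrow> I \<inter> K = {} \<Longrightarrow> euler I F = 0"
  unfolding euler_def by (rule sum.neutral) (auto simp: partial_deriv_notin disjoint_iff)

lemma hpolys_dirac:
  assumes "F \<in> hpolys I (Suc k)" "J \<subseteq> I"
  shows "dirac J F \<in> hpolys I k"
  unfolding dirac_def
proof (rule hpolys_sum)
  fix j assume "j \<in> J"
  then have "pgen j \<in> hpolys I 0"
    using assms(2) by (intro hpolys_single) (auto simp: total_degree_def intro: clifford_alg.gen)
  then show "pgen j * partial_deriv j F \<in> hpolys I k"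
    using hpolys_mult[of _ I 0] hpolys_partial_deriv[OF assms(1)] by fastforce
qed

lemma dirac_hpolys_0: "F \<in> hpolys I 0 \<Longrightarrow> dirac J F = 0"
  by (simp add: dirac_def partial_deriv_hpolys_0)

lemma hpolys_dirac_funpow:
  "F \<in> hpolys I (j + k) \<Longrightarrow> (dirac I ^^ j) F \<in> hpolys I k"
  by (induction j arbitrary: k) (simp_all add: hpolys_dirac)

lemma dirac_funpow_eq_0:
  assumes "F \<in> hpolys I n"
  shows "(dirac I ^^ Suc n) F = 0"
  using hpolys_dirac_funpow[of F I n 0] assms by (simp add: dirac_hpolys_0)

lemma euler_hpolys:
  assumes "F \<in> hpolys I k" "finite I"
  shows "euler I F = poly_scale (of_nat k) F"
  using assms(1)
proof (induction rule: hpolys_induct)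
  case (single \<alpha> a)
  have "var j * partial_deriv j (single \<alpha> a) = of_nat (lookup \<alpha> j) * single \<alpha> a" for j
  proof (cases "lookup \<alpha> j = 0")
    case False
    then have "single j 1 + (\<alpha> - single j 1) = \<alpha>"
      using exponent_minus_iff[of "\<alpha> - single j 1" \<alpha> j] by (simp add: add.commute)
    then show ?thesis
      by (simp add: var_def partial_deriv_single mult_single flip: single_of_nat)
  qed (simp add: partial_deriv_single)
  then have "euler I (single \<alpha> a) = of_nat (\<Sum>j\<in>I. lookup \<alpha> j) * single \<alpha> a"
    by (simp add: euler_def sum_distrib_right)
  then show ?case
    using single(1,3) assms(2) total_degree_superset[of I \<alpha>]
    by (simp add: poly_scale_of_nat flip: of_nat_sum)
qed (simp_all add: euler_def partial_deriv_add distrib_left sum.distrib cpoly.scale_right_distrib)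


section \<open>The Fischer decomposition\<close>

text \<open>The scalar by which the Dirac operator in dimension \<open>d\<close> sends
  \<open>x^j G\<close> to \<open>x^(j-1) G\<close>, for \<open>G\<close> monogenic and homogeneous
  of degree \<open>r\<close>.\<close>

definition fischer_eigenvalue :: "nat \<Rightarrow> nat \<Rightarrow> nat \<Rightarrow> complex" where
  "fischer_eigenvalue d r j = - of_nat (if even j then j else j - 1 + 2 * r + d)"

lemma fischer_eigenvalue_0 [simp]: "fischer_eigenvalue d r 0 = 0"
  by (simp add: fischer_eigenvalue_def)

lemma fischer_eigenvalue_nonzero: "d > 0 \<Longrightarrow> j > 0 \<Longrightarrow> fischer_eigenvalue d r j \<noteq> 0"
  by (simp only: fischer_eigenvalue_def neg_equal_0_iff_equal of_nat_eq_0_iff) auto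

text \<open>The recursion that the anticommutator imposes, the Euler operator acting on
  \<open>x^j G\<close> by \<open>r + j\<close>.\<close>

lemma fischer_eigenvalue_Suc:
  "fischer_eigenvalue d r (Suc j) = - fischer_eigenvalue d r j - 2 * of_nat (r + j) - of_nat d"
  by (auto simp: fischer_eigenvalue_def of_nat_diff elim!: oddE)

text \<open>Only an eigenvector of \<open>euler I\<close> is assumed, so \<open>F\<close> may also
  involve variables outside \<open>I\<close>, as it does for products over two complementary
  subspaces.\<close>

lemma euler_vec_var_power_mult:
  assumes "finite I" "euler I F = poly_scale (of_nat r) F"
  shows "euler I (vec_var I ^ j * F) = poly_scale (of_nat (r + j)) (vec_var I ^ j * F)"
proof (induction j)
  case (Suc j)
  then show ?case
    by (simp add: mult.assoc euler_mult[of _ "vec_var I"] euler_vec_var assms(1)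
        poly_scale_mult_right cpoly.scale_left_distrib distrib_left)
qed (simp add: assms(2))

text \<open>For \<open>j = 0\<close> the truncated exponent \<open>j - 1\<close> is harmless because the eigenvalue vanishes.\<close>

lemma dirac_vec_var_power_mult:
  assumes "finite I" "euler I F = poly_scale (of_nat r) F"
  shows "dirac I (vec_var I ^ j * F) = poly_scale ((- 1) ^ j) (vec_var I ^ j * dirac I F)
    + poly_scale (fischer_eigenvalue (card I) r j) (vec_var I ^ (j - 1) * F)"
proof (induction j)
  case (Suc j)
  let ?X = "vec_var I" and ?\<gamma> = "fischer_eigenvalue (card I) r"
  have pred: "poly_scale (?\<gamma> j) (?X * (?X ^ (j - 1) * F)) = poly_scale (?\<gamma> j) (?X ^ j * F)"
    by (cases j) (simp_all add: mult.assoc)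
  have "dirac I (?X ^ Suc j * F) = - (?X * dirac I (?X ^ j * F))
      - 2 * euler I (?X ^ j * F) - of_nat (card I) * (?X ^ j * F)"
    using dirac_vec_var_mult[OF assms(1)] by (simp add: mult.assoc)
  also have "2 * euler I (?X ^ j * F) = poly_scale (2 * of_nat (r + j)) (?X ^ j * F)"
  proof -
    have "2 * G = poly_scale 2 G" for G
      using poly_scale_of_nat[of 2 G] by simp
    then show ?thesis
      by (simp only: euler_vec_var_power_mult[OF assms] cpoly.scale_scale)
  qed
  also have "of_nat (card I) * (?X ^ j * F) = poly_scale (of_nat (card I)) (?X ^ j * F)"
    by (simp only: poly_scale_of_nat)
  also have "- (?X * dirac I (?X ^ j * F)) = poly_scale (- ((- 1) ^ j)) (?X ^ Suc j * dirac I F)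
      + poly_scale (- ?\<gamma> j) (?X ^ j * F)"
    unfolding Suc distrib_left poly_scale_mult_right pred
    by (simp add: mult.assoc)
  finally show ?case
    by (simp add: fischer_eigenvalue_Suc cpoly.scale_left_diff_distrib cpoly.scale_left_distrib
        diff_diff_eq del: of_nat_add)
qed simp

text \<open>The recursion solves \<open>c (Suc j) * \<gamma> (Suc j) = - ((- 1) ^ j * c j)\<close>,
  the condition that consecutive terms cancel under the Dirac operator.\<close>

primrec fischer_coeff :: "(nat \<Rightarrow> complex) \<Rightarrow> nat \<Rightarrow> complex" where
  "fischer_coeff \<gamma> 0 = 1"
| "fischer_coeff \<gamma> (Suc j) = - ((- 1) ^ j * fischer_coeff \<gamma> j / \<gamma> (Suc j))"

text \<open>A telescoping argument for arbitrary sequences \<open>T\<close> and \<open>U\<close>, so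
  that it applies both to the projection and to the Cauchy--Kovalevskaya type series.\<close>

lemma dirac_fischer_sum:
  assumes step: "\<And>j. j \<le> N \<Longrightarrow>
      dirac I (T j) = poly_scale ((- 1) ^ j) (U j) + poly_scale (\<gamma> j) (U (j - 1))"
    and \<gamma>: "\<gamma> 0 = 0" "\<And>j. 0 < j \<Longrightarrow> j \<le> N \<Longrightarrow> \<gamma> j \<noteq> 0"
    and "U N = 0"
  shows "dirac I (\<Sum>j\<le>N. poly_scale (fischer_coeff \<gamma> j) (T j)) = 0"
proof -
  \<comment> \<open>In a partial sum everything cancels except the first contribution of the last
    term.\<close>
  have "dirac I (\<Sum>j\<le>M. poly_scale (fischer_coeff \<gamma> j) (T j)) =
      poly_scale (fischer_coeff \<gamma> M * (- 1) ^ M) (U M)" if "M \<le> N" for M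
    using that
  proof (induction M)
    case 0
    then show ?case
      using step[of 0] by (simp add: dirac_scale \<gamma>)
  next
    case (Suc M)
    let ?c = "fischer_coeff \<gamma>"
    have c: "?c (Suc M) * \<gamma> (Suc M) = - (?c M * (- 1) ^ M)"
      using \<gamma>(2)[of "Suc M"] Suc.prems by simp
    have "dirac I (\<Sum>j\<le>Suc M. poly_scale (?c j) (T j)) = poly_scale (?c M * (- 1) ^ M) (U M)
        + poly_scale (?c (Suc M)) (poly_scale ((- 1) ^ Suc M) (U (Suc M)) + poly_scale (\<gamma> (Suc M)) (U M))"
      using Suc step[OF Suc.prems] by (simp only: sum.atMost_Suc dirac_add dirac_scale diff_Suc_1)
    also have "\<dots> = poly_scale (?c M * (- 1) ^ M + ?c (Suc M) * \<gamma> (Suc M)) (U M)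
        + poly_scale (?c (Suc M) * (- 1) ^ Suc M) (U (Suc M))"
      by (simp only: cpoly.scale_right_distrib cpoly.scale_left_distrib cpoly.scale_scale ac_simps)
    finally show ?case
      by (simp only: c add.right_inverse cpoly.scale_zero_left add_0)
  qed
  from this[of N] show ?thesis
    by (simp add: assms(4))
qed

text \<open>The eigenvalues use the degree \<open>n - j\<close> because the \<open>j\<close>-th
  Dirac derivative of \<open>F\<close> is homogeneous of that degree.\<close>

definition fischer_proj :: "nat set \<Rightarrow> nat \<Rightarrow> clifford_poly \<Rightarrow> clifford_poly" where
  "fischer_proj I n F = (\<Sum>j\<le>n. poly_scale (fischer_coeff (\<lambda>j. fischer_eigenvalue (card I) (n - j) j) j)
     (vec_var I ^ j * (dirac I ^^ j) F))"

lemma fischer_proj_in_homogeneous_monogenics: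
  assumes I: "finite I" "I \<noteq> {}" and F: "F \<in> hpolys I n"
  shows "fischer_proj I n F \<in> homogeneous_monogenics I n"
  unfolding homogeneous_monogenics_iff
proof
  show "fischer_proj I n F \<in> hpolys I n"
    unfolding fischer_proj_def
  proof (intro hpolys_sum hpolys_scale)
    fix j assume "j \<in> {..n}"
    then show "vec_var I ^ j * (dirac I ^^ j) F \<in> hpolys I n"
      using hpolys_vec_var_power_mult[OF order_refl hpolys_dirac_funpow[of F I j "n - j"], of j] F
      by simp
  qed
  show "dirac I (fischer_proj I n F) = 0"
    unfolding fischer_proj_def
  \<comment> \<open>The last \<open>U\<close> contains the Dirac derivative of order
    \<open>n + 1\<close> of a polynomial of degree \<open>n\<close>, hence vanishes. At
    \<open>j = 0\<close> the term with \<open>j - 1\<close> is multiplied by the eigenvalue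
    0.\<close>
  proof (rule dirac_fischer_sum[where U = "\<lambda>j. vec_var I ^ j * (dirac I ^^ Suc j) F"])
    fix j assume "j \<le> n"
    then have "(dirac I ^^ j) F \<in> hpolys I (n - j)"
      using hpolys_dirac_funpow[of F I j "n - j"] F by simp
    from dirac_vec_var_power_mult[OF I(1) euler_hpolys[OF this I(1)], of j]
    show "dirac I (vec_var I ^ j * (dirac I ^^ j) F) =
        poly_scale ((- 1) ^ j) (vec_var I ^ j * (dirac I ^^ Suc j) F) +
        poly_scale (fischer_eigenvalue (card I) (n - j) j) (vec_var I ^ (j - 1) * (dirac I ^^ Suc (j - 1)) F)"
      by (cases j) simp_all
  next
    fix j :: nat assume "0 < j"
    then show "fischer_eigenvalue (card I) (n - j) j \<noteq> 0"
      using I by (intro fischer_eigenvalue_nonzero) (auto simp: card_gt_0_iff)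
  qed (use dirac_funpow_eq_0[OF F] in simp_all)
qed

text \<open>The leading coefficient of the projection is 1, and all its other terms begin with
  \<open>x\<close>. The degree of \<open>H\<close> is recorded for inductions that continue with
  \<open>H\<close>.\<close>

lemma fischer_step:
  assumes "F \<in> hpolys I n"
  obtains H where "F = fischer_proj I n F + vec_var I * H"
    "n = 0 \<longrightarrow> H = 0" "\<forall>r. n = Suc r \<longrightarrow> H \<in> hpolys I r"
proof
  let ?c = "fischer_coeff (\<lambda>j. fischer_eigenvalue (card I) (n - j) j)"
  let ?H = "- (\<Sum>j<n. poly_scale (?c (Suc j)) (vec_var I ^ j * (dirac I ^^ Suc j) F))"
  have "fischer_proj I n F = F + (\<Sum>j<n. poly_scale (?c (Suc j)) (vec_var I ^ Suc j * (dirac I ^^ Suc j) F))"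
    unfolding fischer_proj_def lessThan_Suc_atMost[symmetric] sum.lessThan_Suc_shift by simp
  then show "F = fischer_proj I n F + vec_var I * ?H"
    by (simp add: sum_distrib_left poly_scale_mult_right mult.assoc del: fischer_coeff.simps)
  show "\<forall>r. n = Suc r \<longrightarrow> ?H \<in> hpolys I r"
  proof (intro allI impI cpoly.subspace_neg[OF subspace_hpolys] hpolys_sum hpolys_scale)
    fix r j assume "j \<in> {..<n}" and that: "n = Suc r"
    then show "vec_var I ^ j * (dirac I ^^ Suc j) F \<in> hpolys I r"
      using hpolys_vec_var_power_mult[OF order_refl hpolys_dirac_funpow[of F I "Suc j" "r - j"], of j]
        assms that by simp
  qed
qed simp

section \<open>Existence and uniqueness of the Fischer decomposition\<close>

lemma fischer_decomposition:
  assumes "finite I" "I \<noteq> {}" "F \<in> hpolys I n"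
  shows "\<exists>f. (\<forall>s. f s \<in> monogenics I) \<and> finite {s. f s \<noteq> 0} \<and>
    F = (\<Sum>s | f s \<noteq> 0. vec_var I ^ s * f s)"
  using assms(3)
proof (induction n arbitrary: F rule: less_induct)
  case (less n)
  have mono0: "0 \<in> monogenics I"
    by (simp add: monogenics_def clifford_polys_def)
  obtain H where H: "F = fischer_proj I n F + vec_var I * H"
    "n = 0 \<longrightarrow> H = 0" "\<forall>r. n = Suc r \<longrightarrow> H \<in> hpolys I r"
    by (rule fischer_step[OF less.prems])
  have "\<exists>g. (\<forall>s. g s \<in> monogenics I) \<and> finite {s. g s \<noteq> 0} \<and>
      H = (\<Sum>s | g s \<noteq> 0. vec_var I ^ s * g s)"
  proof (cases n)
    case 0
    then show ?thesis
      using H(2) mono0 by (intro exI[of _ "\<lambda>_. 0"]) simp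
  next
    case (Suc r)
    then show ?thesis
      using H(3) less.IH by blast
  qed
  then obtain g where g: "\<And>s. g s \<in> monogenics I" "finite {s. g s \<noteq> 0}"
    "H = (\<Sum>s | g s \<noteq> 0. vec_var I ^ s * g s)"
    by blast
  \<comment> \<open>Multiplication by \<open>x\<close> shifts the components of \<open>H\<close> up
    by one and leaves index 0 free for the projection.\<close>
  define f where "f = case_nat (fischer_proj I n F) g"
  have sub: "{s. f s \<noteq> 0} \<subseteq> insert 0 (Suc ` {s. g s \<noteq> 0})"
  proof
    fix s assume "s \<in> {s. f s \<noteq> 0}"
    then show "s \<in> insert 0 (Suc ` {s. g s \<noteq> 0})"
      by (cases s) (auto simp: f_def)
  qed
  have "(\<Sum>s | f s \<noteq> 0. vec_var I ^ s * f s) =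
      (\<Sum>s\<in>insert 0 (Suc ` {s. g s \<noteq> 0}). vec_var I ^ s * f s)"
    by (rule sum.mono_neutral_left) (use sub g(2) in auto)
  also have "\<dots> = fischer_proj I n F + (\<Sum>s | g s \<noteq> 0. vec_var I * (vec_var I ^ s * g s))"
    using g(2) by (simp add: f_def sum.reindex mult.assoc)
  also have "\<dots> = fischer_proj I n F + vec_var I * H"
    by (simp only: g(3) sum_distrib_left)
  also have "\<dots> = F"
    by (rule H(1)[symmetric])
  finally have "F = (\<Sum>s | f s \<noteq> 0. vec_var I ^ s * f s)" ..
  moreover have "f s \<in> monogenics I" for s
    using fischer_proj_in_homogeneous_monogenics[OF assms(1,2) less.prems]
      homogeneous_monogenics_subset g(1)
    by (auto simp: f_def split: nat.splits)
  moreover have "finite {s. f s \<noteq> 0}"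
    using finite_subset[OF sub] g(2) by blast
  ultimately show ?case
    by blast
qed

lemma fischer_decomposition_tail:
  assumes "finite {s. f s \<noteq> 0}"
  shows "\<exists>H. (\<Sum>s | f s \<noteq> 0. vec_var I ^ s * f s) = f 0 + vec_var I * H"
proof -
  \<comment> \<open>The component \<open>f 0\<close> may be zero, in which case 0 is not an index of
    the sum and has to be inserted.\<close>
  have "(\<Sum>s | f s \<noteq> 0. vec_var I ^ s * f s) = (\<Sum>s\<in>insert 0 {s. f s \<noteq> 0}. vec_var I ^ s * f s)"
    by (rule sum.mono_neutral_left) (use assms in auto)
  also have "\<dots> = f 0 + (\<Sum>s\<in>{s. f s \<noteq> 0} - {0}. vec_var I ^ s * f s)"
    using assms by (simp add: sum.insert_remove)
  also have "(\<Sum>s\<in>{s. f s \<noteq> 0} - {0}. vec_var I ^ s * f s) =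
      vec_var I * (\<Sum>s\<in>{s. f s \<noteq> 0} - {0}. vec_var I ^ (s - 1) * f s)"
    unfolding sum_distrib_left
  proof (intro sum.cong refl)
    fix s assume "s \<in> {s. f s \<noteq> 0} - {0}"
    then show "vec_var I ^ s * f s = vec_var I * (vec_var I ^ (s - 1) * f s)"
      by (cases s) (simp_all add: mult.assoc)
  qed
  finally show ?thesis
    by blast
qed

text \<open>The difference \<open>G - G'\<close> is both monogenic and a multiple of
  \<open>x\<close>.\<close>

lemma monogenic_part_unique:
  assumes "G + vec_var I * H = G' + vec_var I * H'" "G \<in> monogenics I" "G' \<in> monogenics I"
  shows "G = G'"
proof -
  have "G - G' = vec_var I * (H' - H)"
    using assms(1) by (simp add: right_diff_distrib algebra_simps)
  moreover have "dirac I (G - G') = 0"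
    using assms(2,3) by (simp add: monogenics_def dirac_diff)
  ultimately have "G - G' = 0"
    by (rule vec_var_mult_monogenic_eq_0)
  then show ?thesis
    by simp
qed

lemma monogenic_proj_eq:
  assumes I: "finite I" "I \<noteq> {}" and F: "F \<in> hpolys I n"
  shows "monogenic_proj I F = fischer_proj I n F"
proof -
  obtain H where H: "F = fischer_proj I n F + vec_var I * H"
    by (rule fischer_step[OF F])
  have mono: "fischer_proj I n F \<in> monogenics I"
    using fischer_proj_in_homogeneous_monogenics[OF I F] homogeneous_monogenics_subset by blast
  have unique: "f 0 = fischer_proj I n F" if f: "\<forall>s. f s \<in> monogenics I" "finite {s. f s \<noteq> 0}"
    "F = (\<Sum>s | f s \<noteq> 0. vec_var I ^ s * f s)" for f
  proof -
    obtain H' where "F = f 0 + vec_var I * H'"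
      using fischer_decomposition_tail[OF f(2)] f(3) by metis
    then show ?thesis
      using monogenic_part_unique[of "f 0" I H' "fischer_proj I n F" H] f(1) mono H by simp
  qed
  obtain f where f: "\<forall>s. f s \<in> monogenics I" "finite {s. f s \<noteq> 0}"
    "F = (\<Sum>s | f s \<noteq> 0. vec_var I ^ s * f s)"
    using fischer_decomposition[OF I F] by blast
  show ?thesis
    unfolding monogenic_proj_def
  proof (rule the_equality)
    show "\<exists>f. (\<forall>s. f s \<in> monogenics I) \<and> finite {s. f s \<noteq> 0} \<and>
        F = (\<Sum>s | f s \<noteq> 0. vec_var I ^ s * f s) \<and> fischer_proj I n F = f 0"
      using f unique[OF f] by (intro exI[of _ f]) simp
  qed (use unique in auto)
qed


section \<open>Products over complementary subspaces\<close>

text \<open>The element \<open>a'\<close> is the image of \<open>a\<close> under the main involution \<open>e\<^sub>j \<mapsto> - e\<^sub>j\<close>.\<close>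

lemma clifford_alg_swap:
  assumes "a \<in> clifford_alg I"
  shows "\<exists>a'\<in>clifford_alg I. \<forall>j. j \<notin> I \<longrightarrow> gen j * a = a' * gen j \<and> a * gen j = gen j * a'"
  using assms
proof induction
  case (const c)
  then show ?case
    by (intro bexI[of _ "clifford_const c"]) (auto simp: clifford_const_commute clifford_alg.const)
next
  case (gen i)
  have "gen j * gen i = - gen i * gen j" "gen i * gen j = gen j * - gen i" if "j \<notin> I" for j
    using gen_relation[of i j] gen that by (auto simp: eq_neg_iff_add_eq_0 add.commute)
  moreover have "- gen i \<in> clifford_alg I"
    using clifford_alg.gen[OF gen] by (simp add: clifford_alg_eq)
  ultimately show ?case
    by blast
next
  case (add a b)
  then obtain a' b' where "a' \<in> clifford_alg I" "b' \<in> clifford_alg I"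
    "\<forall>j. j \<notin> I \<longrightarrow> gen j * a = a' * gen j \<and> a * gen j = gen j * a'"
    "\<forall>j. j \<notin> I \<longrightarrow> gen j * b = b' * gen j \<and> b * gen j = gen j * b'"
    by blast
  then show ?case
    by (intro bexI[of _ "a' + b'"]) (auto simp: distrib_left distrib_right clifford_alg.add)
next
  case (mult a b)
  then obtain a' b' where ab: "a' \<in> clifford_alg I" "b' \<in> clifford_alg I"
    "\<And>j. j \<notin> I \<Longrightarrow> gen j * a = a' * gen j \<and> a * gen j = gen j * a'"
    "\<And>j. j \<notin> I \<Longrightarrow> gen j * b = b' * gen j \<and> b * gen j = gen j * b'"
    by blast
  have "gen j * (a * b) = a' * b' * gen j \<and> a * b * gen j = gen j * (a' * b')" if "j \<notin> I" for j
    using ab(3,4)[OF that] by (metis mult.assoc)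
  then show ?case
    using ab by (blast intro: clifford_alg.mult)
qed

text \<open>The main involution is applied to the coefficients; the variables are central. A single
  \<open>F'\<close> serves all generators outside \<open>I\<close>, so it can be pulled out of sums
  over them.\<close>

lemma hpolys_swap:
  assumes "F \<in> hpolys I k"
  shows "\<exists>F'\<in>hpolys I k. \<forall>j. j \<notin> I \<longrightarrow> pgen j * F = F' * pgen j \<and> F * pgen j = pgen j * F'"
  using assms
proof (induction rule: hpolys_induct)
  case zero
  then show ?case
    by (intro bexI[of _ 0]) (auto simp: hpolys_0)
next
  case (single \<alpha> a)
  then obtain a' where "a' \<in> clifford_alg I"
    "\<forall>j. j \<notin> I \<longrightarrow> gen j * a = a' * gen j \<and> a * gen j = gen j * a'"
    using clifford_alg_swap by blast
  then show ?case
    using single by (intro bexI[of _ "single \<alpha> a'"]) (auto simp: mult_single intro: hpolys_single)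
next
  case (add F G)
  then obtain F' G' where "F' \<in> hpolys I k" "G' \<in> hpolys I k"
    "\<forall>j. j \<notin> I \<longrightarrow> pgen j * F = F' * pgen j \<and> F * pgen j = pgen j * F'"
    "\<forall>j. j \<notin> I \<longrightarrow> pgen j * G = G' * pgen j \<and> G * pgen j = pgen j * G'"
    by blast
  then show ?case
    by (intro bexI[of _ "F' + G'"]) (auto simp: distrib_left distrib_right hpolys_add)
qed

text \<open>Brings a factor \<open>v\<close> to the front, where it can be exchanged for
  \<open>- u\<close> modulo multiples of \<open>x\<close>.\<close>

lemma hpolys_swap_vec_var:
  assumes "F \<in> hpolys I k" "I \<inter> K = {}"
  obtains F' where "F' \<in> hpolys I k" "\<forall>G. F * (vec_var K * G) = vec_var K * (F' * G)"
proof -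
  obtain F' where F': "F' \<in> hpolys I k" "\<And>j. j \<notin> I \<Longrightarrow> F * pgen j = pgen j * F'"
    using hpolys_swap[OF assms(1)] by blast
  have "F * (pgen j * (var j * G)) = pgen j * (var j * (F' * G))" if "j \<in> K" for j G
  proof -
    have "F * (pgen j * (var j * G)) = F * pgen j * (var j * G)"
      by (simp only: mult.assoc)
    also have "F * pgen j = pgen j * F'"
      using F'(2) that assms(2) by blast
    finally show ?thesis
      by (metis mult.assoc var_commute)
  qed
  then show ?thesis
    using F'(1) by (intro that[of F']) (simp_all add: vec_var_mult sum_distrib_left)
qed

text \<open>Derivatives in \<open>K\<close> treat \<open>F\<close> as a constant, and its generators
  pass \<open>F\<close> at the cost of replacing it by \<open>F'\<close>, which leaves
  \<open>F' * dirac K G\<close>.\<close>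

lemma dirac_mult_left_disjoint:
  assumes "F \<in> hpolys I k" "I \<inter> K = {}" "dirac K G = 0"
  shows "dirac K (F * G) = 0"
proof -
  obtain F' where F': "\<And>j. j \<notin> I \<Longrightarrow> pgen j * F = F' * pgen j"
    using hpolys_swap[OF assms(1)] by blast
  have "pgen j * partial_deriv j (F * G) = F' * (pgen j * partial_deriv j G)" if "j \<in> K" for j
  proof -
    have "j \<notin> I"
      using that assms(2) by blast
    then have "partial_deriv j (F * G) = F * partial_deriv j G"
      using partial_deriv_notin[OF assms(1)] by (simp add: partial_deriv_mult)
    then have "pgen j * partial_deriv j (F * G) = pgen j * F * partial_deriv j G"
      by (simp only: mult.assoc)
    then show ?thesis
      by (simp only: F'[OF \<open>j \<notin> I\<close>] mult.assoc)
  qed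
  then have "dirac K (F * G) = F' * dirac K G"
    by (simp add: dirac_def sum_distrib_left)
  then show ?thesis
    by (simp add: assms(3))
qed

text \<open>Here the generators already stand to the left of \<open>F\<close>, so nothing has to be
  exchanged.\<close>

lemma dirac_mult_right_disjoint:
  assumes "G \<in> hpolys K l" "I \<inter> K = {}"
  shows "dirac I (F * G) = dirac I F * G"
proof -
  have "partial_deriv j (F * G) = partial_deriv j F * G" if "j \<in> I" for j
  proof -
    have "j \<notin> K"
      using that assms(2) by blast
    then show ?thesis
      using partial_deriv_notin[OF assms(1)] by (simp add: partial_deriv_mult)
  qed
  then show ?thesis
    by (simp add: dirac_def sum_distrib_right mult.assoc)
qed

lemma hpolys_dirac_pred: "F \<in> hpolys I k \<Longrightarrow> dirac I F \<in> hpolys I (k - 1)"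
  by (cases k) (auto simp: dirac_hpolys_0 hpolys_0 hpolys_dirac)

text \<open>The summand \<open>dirac K\<close> kills the product at each step because
  \<open>G\<close> is monogenic in \<open>K\<close>, so only \<open>dirac I\<close> survives and
  acts on the left factor.\<close>

lemma dirac_funpow_mult_monogenic:
  assumes "finite I" "finite K" "I \<inter> K = {}"
    and "F \<in> hpolys I k" "G \<in> homogeneous_monogenics K i"
  shows "(dirac (I \<union> K) ^^ j) (F * G) = (dirac I ^^ j) F * G"
  using assms(4)
proof (induction j arbitrary: F k)
  case (Suc j)
  have "dirac (I \<union> K) (F * G) = dirac I F * G"
    using assms Suc.prems dirac_mult_left_disjoint[of F I k K G]
      dirac_mult_right_disjoint[of G K i I F]
    by (simp add: dirac_union homogeneous_monogenics_iff)
  then show ?case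
    using Suc.IH[OF hpolys_dirac_pred[OF Suc.prems]] by (simp add: funpow_swap1)
qed simp

text \<open>For \<open>j > s\<close>, where \<open>s - j\<close> truncates, the product contains the factor \<open>r = s\<close>, which is \<open>0\<close>.\<close>

lemma dirac_funpow_vec_var_power:
  assumes "finite I" "F \<in> homogeneous_monogenics I k"
  shows "(dirac I ^^ j) (vec_var I ^ s * F) =
    poly_scale (\<Prod>r<j. fischer_eigenvalue (card I) k (s - r)) (vec_var I ^ (s - j) * F)"
proof (induction j)
  case (Suc j)
  have "dirac I (vec_var I ^ t * F) = poly_scale (fischer_eigenvalue (card I) k t) (vec_var I ^ (t - 1) * F)" for t
    using dirac_vec_var_power_mult[OF assms(1) euler_hpolys[OF _ assms(1)], of F k t] assms(2)
    by (simp add: homogeneous_monogenics_iff)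
  then show ?case
    by (simp add: Suc dirac_scale)
qed simp

section \<open>Orthogonality of the products before projection\<close>

lemma dirac_funpow_vec_var_power_eq_0:
  assumes "finite I" "F \<in> homogeneous_monogenics I k" "s < j"
  shows "(dirac I ^^ j) (vec_var I ^ s * F) = 0"
proof -
  have "(\<Prod>r<j. fischer_eigenvalue (card I) k (s - r)) = 0"
    using assms(3) by (auto intro!: prod_zero bexI[of _ s])
  then show ?thesis
    by (simp add: dirac_funpow_vec_var_power[OF assms(1,2)])
qed

text \<open>The higher power of \<open>x\<close> is moved across as an iterated Dirac operator,
  which annihilates the lower power.\<close>

lemma fischer_inner_vec_var_power:
  assumes "finite I" "F \<in> homogeneous_monogenics I k" "G \<in> homogeneous_monogenics I l" "s \<noteq> t"
  shows "fischer_inner (vec_var I ^ s * F) (vec_var I ^ t * G) = 0"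
proof (cases "s < t")
  case True
  then show ?thesis
    by (simp add: fischer_inner_vec_var_power_right dirac_funpow_vec_var_power_eq_0[OF assms(1,2)])
next
  case False
  then have "fischer_inner (vec_var I ^ t * G) (vec_var I ^ s * F) = 0"
    using assms(4)
    by (simp add: fischer_inner_vec_var_power_right dirac_funpow_vec_var_power_eq_0[OF assms(1,3)])
  then show ?thesis
    by (metis fischer_inner_cnj complex_cnj_zero)
qed

text \<open>Moving all \<open>s\<close> factors across returns \<open>F\<close> multiplied by a
  product of eigenvalues with positive index, hence by a nonzero scalar.\<close>

lemma fischer_inner_vec_var_power_same:
  assumes "finite I" "I \<noteq> {}" "F \<in> homogeneous_monogenics I k"
  shows "fischer_inner (vec_var I ^ s * F) (vec_var I ^ s * G) = 0 \<longleftrightarrow> fischer_inner F G = 0"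
proof -
  have "fischer_eigenvalue (card I) k (s - r) \<noteq> 0" if "r < s" for r
    using that assms by (intro fischer_eigenvalue_nonzero) (auto simp: card_gt_0_iff)
  then have "(\<Prod>r<s. fischer_eigenvalue (card I) k (s - r)) \<noteq> 0"
    by simp
  then show ?thesis
    by (simp add: fischer_inner_vec_var_power_right dirac_funpow_vec_var_power[OF assms(1,3)]
        fischer_inner_scale_left del: cnj_prod)
qed

lemma fischer_inner_hpolys_degree:
  assumes "F \<in> hpolys I k" "G \<in> hpolys J l" "k \<noteq> l"
  shows "fischer_inner F G = 0"
  unfolding fischer_inner_superset[OF finite_keys order_refl]
proof (rule sum.neutral, rule ballI)
  fix \<alpha> assume "\<alpha> \<in> keys F"
  then have "total_degree \<alpha> = k"
    using assms(1) by (simp add: hpolys_iff in_keys_iff)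
  then have "lookup G \<alpha> = 0"
    using assms(2,3) unfolding hpolys_iff by blast
  then show "of_nat (exponent_fact \<alpha>) * scalar_part (clifford_conj (lookup F \<alpha>) * lookup G \<alpha>) = 0"
    by simp
qed

lemma fischer_inner_mult_single:
  assumes "I \<inter> K = {}" "keys \<alpha> \<subseteq> I" "keys \<alpha>' \<subseteq> I" "keys \<beta> \<subseteq> K" "keys \<beta>' \<subseteq> K"
    "a \<in> clifford_alg I" "a' \<in> clifford_alg I" "b \<in> clifford_alg K" "b' \<in> clifford_alg K"
  shows "fischer_inner (single \<alpha> a * single \<beta> b) (single \<alpha>' a' * single \<beta>' b') =
    fischer_inner (single \<alpha> a) (single \<alpha>' a') * fischer_inner (single \<beta> b) (single \<beta>' b')"
proof (cases "\<alpha>' = \<alpha> \<and> \<beta>' = \<beta>")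
  case False
  \<comment> \<open>Exponents supported on complementary index sets can be recovered from their sum,
    so the two product monomials differ and both sides are 0.\<close>
  have "\<alpha>' + \<beta>' \<noteq> \<alpha> + \<beta>"
  proof
    assume eq: "\<alpha>' + \<beta>' = \<alpha> + \<beta>"
    have "lookup \<alpha>' j = lookup \<alpha> j \<and> lookup \<beta>' j = lookup \<beta> j" for j
    proof -
      have "lookup \<alpha>' j + lookup \<beta>' j = lookup \<alpha> j + lookup \<beta> j"
        using eq by (metis lookup_add)
      moreover have "lookup \<beta>' j = 0 \<and> lookup \<beta> j = 0 \<or> lookup \<alpha>' j = 0 \<and> lookup \<alpha> j = 0"
        using assms(1-5) by (metis disjoint_iff in_keys_iff subsetD)
      ultimately show ?thesis
        by auto
    qed
    then have "\<alpha>' = \<alpha> \<and> \<beta>' = \<beta>"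
      by (auto intro: poly_mapping_eqI)
    then show False
      using False by blast
  qed
  then show ?thesis
    using False by (auto simp: mult_single fischer_inner_single lookup_single when_def)
next
  case True
  have conj: "clifford_conj a \<in> clifford_alg I" "clifford_conj b \<in> clifford_alg K"
    using assms(6,8) by (auto simp: clifford_alg_eq)
  have "scalar_part (clifford_conj (a * b) * (a' * b')) =
      scalar_part (clifford_conj b * (clifford_conj a * a' * b'))"
    by (simp only: clifford_conj_mult mult.assoc)
  \<comment> \<open>The trace property moves \<open>clifford_conj b\<close> to the far right, which
    separates the factors over \<open>I\<close> from those over \<open>K\<close>.\<close>
  also have "\<dots> = scalar_part ((clifford_conj a * a') * (b' * clifford_conj b))"
    by (subst scalar_part_commute) (simp only: mult.assoc)
  also have "\<dots> = scalar_part (clifford_conj a * a') * scalar_part (clifford_conj b * b')"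
    using scalar_part_times_disjoint[of "clifford_conj a * a'" I "b' * clifford_conj b" K]
      assms conj by (simp add: clifford_alg.mult scalar_part_commute[of b'])
  finally have "scalar_part (clifford_conj (a * b) * (a' * b')) =
      scalar_part (clifford_conj a * a') * scalar_part (clifford_conj b * b')" .
  moreover have "keys \<alpha> \<inter> keys \<beta> = {}"
    using assms(1,2,4) by blast
  ultimately show ?thesis
    using True by (simp add: mult_single fischer_inner_single exponent_fact_add_disjoint)
qed

text \<open>Both sides are additive in each of the four polynomials, so the claim reduces to
  monomials.\<close>

lemma fischer_inner_mult_disjoint:
  assumes "I \<inter> K = {}" "F \<in> hpolys I k" "F' \<in> hpolys I k'" "G \<in> hpolys K l" "G' \<in> hpolys K l'"
  shows "fischer_inner (F * G) (F' * G') = fischer_inner F F' * fischer_inner G G'"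
  using assms(2)
proof (induction rule: hpolys_induct)
  case a: (single \<alpha> a)
  from assms(4) show ?case
  proof (induction rule: hpolys_induct)
    case b: (single \<beta> b)
    from assms(3) show ?case
    proof (induction rule: hpolys_induct)
      case a': (single \<alpha>' a')
      from assms(5) show ?case
      proof (induction rule: hpolys_induct)
        case b': (single \<beta>' b')
        show ?case
          using assms(1) a(1,2) b(1,2) a'(1,2) b'(1,2) by (intro fischer_inner_mult_single)
      qed (simp_all add: distrib_left fischer_inner_add_right)
    qed (simp_all add: distrib_left distrib_right fischer_inner_add_right)
  qed (simp_all add: distrib_left distrib_right fischer_inner_add_left)
qed (simp_all add: distrib_right fischer_inner_add_left)

section \<open>Products that are multiples of \<open>x\<close> vanish\<close>

text \<open>The Cauchy--Kovalevskaya type series \<open>G = (\<Sum>j. c\<^sub>j v\<^sup>j \<partial>\<^sup>j F)\<close> is monogenic, hence orthogonal to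
  \<open>F = x H\<close>, but every term except the leading one \<open>F\<close> is orthogonal to \<open>F\<close>.\<close>

lemma vec_var_mult_product_eq_0:
  assumes fin: "finite I" "finite K" "K \<noteq> {}" and disj: "I \<inter> K = {}"
    and A: "A \<in> hpolys I a" and B: "B \<in> homogeneous_monogenics K i"
    and H: "A * B = vec_var (I \<union> K) * H"
  shows "A * B = 0"
proof (rule fischer_inner_self_eq_0)
  let ?v = "vec_var K"
  define h where "h = (\<lambda>j. (dirac I ^^ j) A * B)"
  define \<gamma> where "\<gamma> = fischer_eigenvalue (card K) i"
  define G where "G = (\<Sum>j\<le>a. poly_scale (fischer_coeff \<gamma> j) (?v ^ j * h j))"
  have B': "B \<in> hpolys K i" "dirac K B = 0"
    using B by (simp_all add: homogeneous_monogenics_iff)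
  have dA: "(dirac I ^^ j) A \<in> hpolys I (a - j)" for j
  proof (induction j)
    case (Suc j)
    then show ?case
      using hpolys_dirac_pred by fastforce
  qed (simp add: A)
  have dK: "dirac K (h j) = 0" for j
    unfolding h_def by (rule dirac_mult_left_disjoint[OF dA disj B'(2)])
  \<comment> \<open>The left factor is free of the variables of \<open>K\<close>, so only the degree
    of \<open>B\<close> counts.\<close>
  have euler: "euler K (h j) = poly_scale (of_nat i) (h j)" for j
    unfolding h_def using euler_disjoint[OF dA, of K j] euler_hpolys[OF B'(1) fin(2)] disj
    by (simp add: euler_mult poly_scale_mult_right Int_commute)
  have dI: "dirac I (?v ^ j * F) = poly_scale ((- 1) ^ j) (?v ^ j * dirac I F)" for j F
  proof (induction j)
    case (Suc j)
    then show ?case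
      using dirac_vec_var_mult_disjoint[OF disj, of "?v ^ j * F"]
      by (simp add: mult.assoc poly_scale_mult_right)
  qed simp
  have "dirac (I \<union> K) G = 0"
    unfolding G_def
  proof (rule dirac_fischer_sum[where U = "\<lambda>j. ?v ^ j * h (Suc j)"])
    fix j assume "j \<le> a"
    have "dirac I (h j) = h (Suc j)"
      unfolding h_def using dirac_mult_right_disjoint[OF B'(1) disj] by simp
    then show "dirac (I \<union> K) (?v ^ j * h j) =
        poly_scale ((- 1) ^ j) (?v ^ j * h (Suc j)) + poly_scale (\<gamma> j) (?v ^ (j - 1) * h (Suc (j - 1)))"
      using dirac_vec_var_power_mult[OF fin(2) euler, of j j] dI[of j "h j"]
      by (cases j) (simp_all add: dirac_union fin disj dK \<gamma>_def)
  next
    show "\<gamma> j \<noteq> 0" if "0 < j" for j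
      unfolding \<gamma>_def using fin that by (intro fischer_eigenvalue_nonzero) (auto simp: card_gt_0_iff)
    show "?v ^ a * h (Suc a) = 0"
      using dirac_funpow_eq_0[OF A] by (simp add: h_def)
  qed (simp add: \<gamma>_def)
  then have "fischer_inner (A * B) G = 0"
    unfolding H fischer_inner_vec_var_left by simp
  moreover have "fischer_inner (A * B) G = (\<Sum>j\<le>a. if j = 0 then fischer_inner (A * B) (A * B) else 0)"
    unfolding G_def fischer_inner_sum_right fischer_inner_scale_right
  proof (intro sum.cong refl)
    fix j
    \<comment> \<open>For \<open>j > 0\<close> one factor \<open>v\<close> is moved to the left
      argument and becomes \<open>dirac K (A * B) = 0\<close>.\<close>
    show "fischer_coeff \<gamma> j * fischer_inner (A * B) (?v ^ j * h j) =
        (if j = 0 then fischer_inner (A * B) (A * B) else 0)"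
      using dK[of 0] by (cases j) (simp_all add: mult.assoc fischer_inner_vec_var_right h_def)
  qed
  ultimately show "fischer_inner (A * B) (A * B) = 0"
    by simp
qed

section \<open>Spanning modulo multiples of \<open>x\<close>\<close>

lemma clifford_blade_sum:
  "a = (\<Sum>A | blade_coeff a A \<noteq> 0. clifford_const (blade_coeff a A) * blade A)"
proof (rule clifford_eqI)
  fix B
  have "blade_coeff (\<Sum>A | blade_coeff a A \<noteq> 0. clifford_const (blade_coeff a A) * blade A) B
      = (\<Sum>A | blade_coeff a A \<noteq> 0. if B = A then blade_coeff a A else 0)"
    unfolding blade_coeff_sum by (intro sum.cong refl) (simp add: blade_coeff_blade finite_blade)
  then show "blade_coeff a B =
      blade_coeff (\<Sum>A | blade_coeff a A \<noteq> 0. clifford_const (blade_coeff a A) * blade A) B"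
    by simp
qed

lemma blade_split:
  assumes "finite A" "A \<subseteq> I \<union> K" "I \<inter> K = {}"
  shows "blade A = clifford_const (blade_sign (A \<inter> I) (A \<inter> K)) * (blade (A \<inter> I) * blade (A \<inter> K))"
proof -
  have "sym_diff (A \<inter> I) (A \<inter> K) = A"
    using assms(2,3) by auto
  then show ?thesis
    using assms(1) by (simp add: blade_times_blade flip: mult.assoc clifford_const_mult)
qed

lemma exponent_split:
  fixes \<alpha> :: "nat \<Rightarrow>\<^sub>0 nat"
  assumes "keys \<alpha> \<subseteq> I \<union> K" "I \<inter> K = {}"
  obtains \<beta> \<gamma> where "\<alpha> = \<beta> + \<gamma>" "keys \<beta> \<subseteq> I" "keys \<gamma> \<subseteq> K"
proof
  let ?r = "\<lambda>S. \<Sum>j\<in>S. single j (lookup \<alpha> j)"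
  have "keys \<alpha> = (keys \<alpha> \<inter> I) \<union> (keys \<alpha> \<inter> K)"
    using assms(1) by blast
  then have "?r (keys \<alpha>) = ?r (keys \<alpha> \<inter> I) + ?r (keys \<alpha> \<inter> K)"
    using sum.union_disjoint[of "keys \<alpha> \<inter> I" "keys \<alpha> \<inter> K" "\<lambda>j. single j (lookup \<alpha> j)"] assms(2)
    by (metis finite_Int finite_keys inf_bot_right inf_commute inf_left_commute)
  then show "\<alpha> = ?r (keys \<alpha> \<inter> I) + ?r (keys \<alpha> \<inter> K)"
    by (simp only: poly_mapping_sum_single[symmetric])
  show "keys (?r (keys \<alpha> \<inter> I)) \<subseteq> I" "keys (?r (keys \<alpha> \<inter> K)) \<subseteq> K"
    using keys_sum[of "\<lambda>j. single j (lookup \<alpha> j)" "keys \<alpha> \<inter> I"]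
      keys_sum[of "\<lambda>j. single j (lookup \<alpha> j)" "keys \<alpha> \<inter> K"] by auto
qed

text \<open>Every monomial times a blade splits, up to a sorting sign, into a factor over
  \<open>I\<close> and a factor over \<open>K\<close> whose degrees add up to
  \<open>n\<close>.\<close>

lemma hpolys_union_subset:
  assumes disj: "I \<inter> K = {}" and T: "cpoly.subspace T"
    and prod: "\<And>a d A B. a + d = n \<Longrightarrow> A \<in> hpolys I a \<Longrightarrow> B \<in> hpolys K d \<Longrightarrow> A * B \<in> T"
  shows "hpolys (I \<union> K) n \<subseteq> T"
proof
  fix F assume "F \<in> hpolys (I \<union> K) n"
  then show "F \<in> T"
  proof (induction rule: hpolys_induct)
    case (single \<alpha> a)
    obtain \<beta> \<gamma> where \<alpha>: "\<alpha> = \<beta> + \<gamma>" "keys \<beta> \<subseteq> I" "keys \<gamma> \<subseteq> K"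
      using exponent_split[OF single(1) disj] .
    have "single \<alpha> (clifford_const (blade_coeff a A) * blade A) \<in> T" if "blade_coeff a A \<noteq> 0" for A
    proof -
      have A: "finite A" "A \<subseteq> I \<union> K"
        using that single(2) by (auto simp: clifford_alg_eq finite_blade)
      let ?c = "blade_coeff a A * blade_sign (A \<inter> I) (A \<inter> K)"
      have "single \<alpha> (clifford_const (blade_coeff a A) * blade A) =
          poly_scale ?c (single \<beta> (blade (A \<inter> I)) * single \<gamma> (blade (A \<inter> K)))"
        by (subst blade_split[OF A disj])
          (simp add: poly_scale_def mult_single \<alpha>(1) clifford_const_mult mult.assoc)
      moreover have "single \<beta> (blade (A \<inter> I)) * single \<gamma> (blade (A \<inter> K)) \<in> T"
        using A(1) \<alpha> single(3)
        by (intro prod[of "total_degree \<beta>" "total_degree \<gamma>"] hpolys_single blade_in_clifford_alg)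
          (auto simp: total_degree_add)
      ultimately show ?thesis
        using cpoly.subspace_scale[OF T] by simp
    qed
    then have "(\<Sum>A | blade_coeff a A \<noteq> 0. single \<alpha> (clifford_const (blade_coeff a A) * blade A)) \<in> T"
      by (intro cpoly.subspace_sum[OF T]) auto
    moreover have "(\<Sum>x\<in>S. single \<alpha> (g x)) = single \<alpha> (sum g S)" for g :: "nat set \<Rightarrow> clifford" and S
      by (induction S rule: infinite_finite_induct) (simp_all add: single_add)
    ultimately show ?case
      using clifford_blade_sum[of a] by metis
  qed (auto intro: cpoly.subspace_0[OF T] cpoly.subspace_add[OF T])
qed

text \<open>In the application \<open>T\<close> is the sum of the span of the projections and the
  multiples of \<open>x\<close>. Fischer decompositions in \<open>u\<close> and in \<open>v\<close>
  reduce general products to those with monogenic factors.\<close>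

lemma hpolys_subset_monogenic_products:
  assumes fin: "finite I" "finite K" and ne: "I \<noteq> {}" "K \<noteq> {}" and disj: "I \<inter> K = {}"
    and T: "cpoly.subspace T"
    and ideal: "\<And>H. vec_var (I \<union> K) * H \<in> T"
    and gens: "\<And>s k i F G. s + k + i = n \<Longrightarrow> F \<in> homogeneous_monogenics I k \<Longrightarrow>
      G \<in> homogeneous_monogenics K i \<Longrightarrow> vec_var I ^ s * F * G \<in> T"
  shows "hpolys (I \<union> K) n \<subseteq> T"
proof (rule hpolys_union_subset[OF disj T])
  \<comment> \<open>Induction on the degree of \<open>A\<close>: the remainder \<open>u H\<close> of
    its Fischer decomposition is absorbed by raising \<open>s\<close>, which is why \<open>s\<close>
    is kept arbitrary.\<close>
  have 1: "vec_var I ^ s * A * B \<in> T"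
    if "A \<in> hpolys I a" "B \<in> homogeneous_monogenics K i" "s + a + i = n" for s a i A B
    using that
  proof (induction a arbitrary: s A)
    case 0
    then show ?case
      using dirac_hpolys_0 by (intro gens[of s 0 i]) (auto simp: homogeneous_monogenics_iff)
  next
    case (Suc a)
    obtain H where H: "A = fischer_proj I (Suc a) A + vec_var I * H"
      "Suc a = 0 \<longrightarrow> H = 0" "\<forall>r. Suc a = Suc r \<longrightarrow> H \<in> hpolys I r"
      by (rule fischer_step[OF Suc.prems(1)])
    have "vec_var I ^ s * fischer_proj I (Suc a) A * B \<in> T"
      by (rule gens[OF _ fischer_proj_in_homogeneous_monogenics[OF fin(1) ne(1) Suc.prems(1)]
          Suc.prems(2)]) (rule Suc.prems(3))
    moreover have "vec_var I ^ Suc s * H * B \<in> T"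
      using Suc.prems H(3) by (intro Suc.IH) auto
    ultimately have "vec_var I ^ s * fischer_proj I (Suc a) A * B + vec_var I ^ Suc s * H * B \<in> T"
      by (rule cpoly.subspace_add[OF T])
    also have "vec_var I ^ Suc s * H = vec_var I ^ s * (vec_var I * H)"
      by (simp only: power_Suc2 mult.assoc)
    also have "vec_var I ^ s * fischer_proj I (Suc a) A * B + vec_var I ^ s * (vec_var I * H) * B =
        vec_var I ^ s * A * B"
      by (subst (2) H(1)) (simp only: distrib_left distrib_right)
    finally show ?case .
  qed
  show "A * B \<in> T" if "a + d = n" "A \<in> hpolys I a" "B \<in> hpolys K d" for a d A B
    using that
  proof (induction d arbitrary: a A B)
    case 0
    then show ?case
      using 1[of A a B 0 0] dirac_hpolys_0 by (auto simp: homogeneous_monogenics_iff)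
  next
    case (Suc d)
    obtain H where H: "B = fischer_proj K (Suc d) B + vec_var K * H"
      "Suc d = 0 \<longrightarrow> H = 0" "\<forall>r. Suc d = Suc r \<longrightarrow> H \<in> hpolys K r"
      by (rule fischer_step[OF Suc.prems(3)])
    obtain A' where A': "A' \<in> hpolys I a" "\<forall>G. A * (vec_var K * G) = vec_var K * (A' * G)"
      using hpolys_swap_vec_var[OF Suc.prems(2) disj] .
    have "vec_var I ^ 0 * A * fischer_proj K (Suc d) B \<in> T"
      by (rule 1[OF Suc.prems(2) fischer_proj_in_homogeneous_monogenics[OF fin(2) ne(2)
          Suc.prems(3)]]) (use Suc.prems(1) in simp)
    \<comment> \<open>Since \<open>v = x - u\<close>, the remainder \<open>A v H = v A' H\<close>
      becomes a multiple of \<open>x\<close> minus \<open>u A' H\<close>. The latter has the same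
      total degree but a right factor of lower degree, so the induction on \<open>d\<close>
      applies.\<close>
    moreover have "vec_var (I \<union> K) * (A' * H) - vec_var I * A' * H \<in> T"
      using Suc.prems(1) A'(1) H(3)
      by (intro cpoly.subspace_diff[OF T] ideal Suc.IH[of "Suc a"] hpolys_vec_var_mult) auto
    moreover have "vec_var (I \<union> K) * (A' * H) - vec_var I * A' * H = A * (vec_var K * H)"
      by (simp add: vec_var_union fin disj A'(2) distrib_right mult.assoc)
    ultimately have "A * fischer_proj K (Suc d) B + A * (vec_var K * H) \<in> T"
      using cpoly.subspace_add[OF T] by simp
    also have "A * fischer_proj K (Suc d) B + A * (vec_var K * H) = A * B"
      by (subst (2) H(1)) (simp only: distrib_left)
    finally show ?case .
  qed
qed

section \<open>Orthogonality of the projections\<close>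

lemma fischer_inner_fischer_proj:
  assumes I: "finite I" "I \<noteq> {}" and F: "F \<in> hpolys I n" "G \<in> hpolys I n"
    and orth: "\<And>j. fischer_inner ((dirac I ^^ j) F) ((dirac I ^^ j) G) = 0"
  shows "fischer_inner (fischer_proj I n F) (fischer_proj I n G) = 0"
proof -
  obtain H where H: "F = fischer_proj I n F + vec_var I * H"
    by (rule fischer_step[OF F(1)])
  have "fischer_inner (vec_var I * H) (fischer_proj I n G) = 0"
    using fischer_proj_in_homogeneous_monogenics[OF I F(2)]
    by (simp add: fischer_inner_vec_var_left homogeneous_monogenics_iff)
  \<comment> \<open>The first projection may be replaced by \<open>F\<close>, because the difference
    is a multiple of \<open>x\<close> and thus orthogonal to monogenics. Expanding the second one
    and moving \<open>x^j\<close> across leaves only the pairings in \<open>orth\<close>.\<close>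
  then have "fischer_inner (fischer_proj I n F) (fischer_proj I n G) =
      fischer_inner (fischer_proj I n F + vec_var I * H) (fischer_proj I n G)"
    by (simp add: fischer_inner_add_left)
  also have "\<dots> = fischer_inner F (fischer_proj I n G)"
    by (simp only: H[symmetric])
  also have "\<dots> = 0"
    by (simp add: fischer_proj_def fischer_inner_sum_right fischer_inner_scale_right
        fischer_inner_vec_var_power_right orth)
  finally show ?thesis .
qed

text \<open>The inner product factors over \<open>I\<close> and \<open>K\<close>. The equivalence
  supplies both the orthogonality of different products and the nonvanishing of each one.\<close>

lemma fischer_inner_monogenic_products:
  assumes "finite I" "I \<noteq> {}" "I \<inter> K = {}"
    and F: "F \<in> homogeneous_monogenics I k" "F' \<in> homogeneous_monogenics I k'"
    and G: "G \<in> homogeneous_monogenics K i" "G' \<in> homogeneous_monogenics K i'"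
  shows "fischer_inner (vec_var I ^ s * F * G) (vec_var I ^ t * F' * G') = 0 \<longleftrightarrow>
    s \<noteq> t \<or> fischer_inner F F' = 0 \<or> fischer_inner G G' = 0"
proof -
  have "vec_var I ^ s * F \<in> hpolys I (s + k)" "vec_var I ^ t * F' \<in> hpolys I (t + k')"
    using F by (auto intro: hpolys_vec_var_power_mult simp: homogeneous_monogenics_iff)
  then have "fischer_inner (vec_var I ^ s * F * G) (vec_var I ^ t * F' * G') =
      fischer_inner (vec_var I ^ s * F) (vec_var I ^ t * F') * fischer_inner G G'"
    using G assms(3) by (intro fischer_inner_mult_disjoint) (auto simp: homogeneous_monogenics_iff)
  moreover have "fischer_inner (vec_var I ^ s * F) (vec_var I ^ t * F') = 0 \<longleftrightarrow>
      s \<noteq> t \<or> fischer_inner F F' = 0"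
    using fischer_inner_vec_var_power[OF assms(1) F, of s t]
      fischer_inner_vec_var_power_same[OF assms(1,2) F(1), of s F'] by auto
  ultimately show ?thesis
    by simp
qed

lemma monogenic_products_in_hpolys:
  assumes "F \<in> homogeneous_monogenics I k" "G \<in> homogeneous_monogenics K i"
  shows "vec_var I ^ s * F * G \<in> hpolys (I \<union> K) (s + k + i)"
proof (rule hpolys_mult)
  show "vec_var I ^ s * F \<in> hpolys (I \<union> K) (s + k)"
    using assms(1) hpolys_mono[of I "I \<union> K"]
    by (intro hpolys_vec_var_power_mult) (auto simp: homogeneous_monogenics_iff)
  show "G \<in> hpolys (I \<union> K) i"
    using assms(2) hpolys_mono[of K "I \<union> K"] by (auto simp: homogeneous_monogenics_iff)
qed

lemma fischer_inner_proj_monogenic_products: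
  assumes fin: "finite I" "finite K" and ne: "I \<noteq> {}" "K \<noteq> {}" and disj: "I \<inter> K = {}"
    and F: "F \<in> homogeneous_monogenics I k" "F' \<in> homogeneous_monogenics I k'"
    and G: "G \<in> homogeneous_monogenics K i" "G' \<in> homogeneous_monogenics K i'"
    and n: "s + k + i = n" "t + k' + i' = n"
    and orth: "s \<noteq> t \<or> fischer_inner F F' = 0 \<or> fischer_inner G G' = 0"
  shows "fischer_inner (fischer_proj (I \<union> K) n (vec_var I ^ s * F * G))
    (fischer_proj (I \<union> K) n (vec_var I ^ t * F' * G')) = 0"
proof (rule fischer_inner_fischer_proj)
  show "vec_var I ^ s * F * G \<in> hpolys (I \<union> K) n" "vec_var I ^ t * F' * G' \<in> hpolys (I \<union> K) n"
    using monogenic_products_in_hpolys[OF F(1) G(1), of s]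
      monogenic_products_in_hpolys[OF F(2) G(2), of t] n by simp_all
  fix j
  have D: "(dirac (I \<union> K) ^^ j) (vec_var I ^ s * F * G) = (dirac I ^^ j) (vec_var I ^ s * F) * G"
    if "F \<in> homogeneous_monogenics I k" "G \<in> homogeneous_monogenics K i" for F G k i s
    using that by (intro dirac_funpow_mult_monogenic[OF fin disj, of _ "s + k" _ i]
        hpolys_vec_var_power_mult) (auto simp: homogeneous_monogenics_iff)
  show "fischer_inner ((dirac (I \<union> K) ^^ j) (vec_var I ^ s * F * G))
      ((dirac (I \<union> K) ^^ j) (vec_var I ^ t * F' * G')) = 0"
  \<comment> \<open>Distinct \<open>s\<close> and \<open>t\<close> give distinct
    \<open>s - j\<close> and \<open>t - j\<close> only as long as neither difference truncates;
    beyond that one of the two derivatives is 0.\<close>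
  proof (cases "j \<le> s \<and> j \<le> t")
    case True
    then have "s - j \<noteq> t - j \<or> fischer_inner F F' = 0 \<or> fischer_inner G G' = 0"
      using orth by auto
    then have "fischer_inner (vec_var I ^ (s - j) * F * G) (vec_var I ^ (t - j) * F' * G') = 0"
      using fischer_inner_monogenic_products[OF fin(1) ne(1) disj F G] by blast
    then show ?thesis
      by (simp add: D[OF F(1) G(1)] D[OF F(2) G(2)] dirac_funpow_vec_var_power[OF fin(1) F(1)]
          dirac_funpow_vec_var_power[OF fin(1) F(2)] poly_scale_mult_left
          fischer_inner_scale_left fischer_inner_scale_right)
  next
    case False
    then show ?thesis
      using dirac_funpow_vec_var_power_eq_0[OF fin(1) F(1), of s j]
        dirac_funpow_vec_var_power_eq_0[OF fin(1) F(2), of t j]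
      by (auto simp: D[OF F(1) G(1)] D[OF F(2) G(2)])
  qed
qed (use fin ne in auto)

section \<open>Assembling the orthogonal basis\<close>

lemma subspace_homogeneous_monogenics: "cpoly.subspace (homogeneous_monogenics I k)"
  unfolding cpoly.subspace_def
  by (auto simp: homogeneous_monogenics_iff hpolys_0 hpolys_add hpolys_scale dirac_add dirac_scale)

text \<open>Definiteness and orthogonality give injectivity, since a repeated value would be
  orthogonal to itself. They give independence as well, since pairing a linear relation with one
  member isolates its coefficient.\<close>

lemma orthogonal_basisI:
  assumes orth: "\<And>x y. x \<in> J \<Longrightarrow> y \<in> J \<Longrightarrow> x \<noteq> y \<Longrightarrow> fischer_inner (b x) (b y) = 0"
    and nonzero: "\<And>x. x \<in> J \<Longrightarrow> b x \<noteq> 0"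
    and span: "cpoly.span (b ` J) = V"
  shows "orthogonal_basis J b V"
proof -
  have self: "fischer_inner (b x) (b x) \<noteq> 0" if "x \<in> J" for x
    using nonzero[OF that] fischer_inner_self_eq_0 by blast
  have "inj_on b J"
    using orth self by (metis inj_onI)
  moreover have "cpoly.independent (b ` J)"
    unfolding cpoly.dependent_explicit
  proof safe
    fix S u v assume S: "finite S" "S \<subseteq> b ` J" "(\<Sum>v\<in>S. poly_scale (u v) v) = 0" "v \<in> S"
      and "u v \<noteq> 0"
    obtain x where x: "x \<in> J" "v = b x"
      using S by blast
    have "fischer_inner v w = 0" if "w \<in> S" "w \<noteq> v" for w
      using that S(2) x orth by blast
    then have "fischer_inner v (\<Sum>w\<in>S. poly_scale (u w) w) =
        (\<Sum>w\<in>S. if w = v then u v * fischer_inner v v else 0)"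
      unfolding fischer_inner_sum_right fischer_inner_scale_right
      by (intro sum.cong refl) auto
    then have "u v * fischer_inner v v = 0"
      using S by simp
    then show False
      using \<open>u v \<noteq> 0\<close> self x by simp
  qed
  ultimately show ?thesis
    using orth span by (simp add: orthogonal_basis_def is_basis_def)
qed

theorem theorem10:
  fixes p q m n :: nat
    and P Q :: "nat \<Rightarrow> nat \<Rightarrow> clifford_poly"
  assumes "p \<ge> 1" and "q \<ge> 1" and "m = p + q"
    and "\<And>k. orthonormal_basis {1..cpoly.dim (homogeneous_monogenics {1..p} k)} (P k)
           (homogeneous_monogenics {1..p} k)"
    and "\<And>i. orthonormal_basis {1..cpoly.dim (homogeneous_monogenics {p+1..m} i)} (Q i)
           (homogeneous_monogenics {p+1..m} i)"
  shows "orthogonal_basis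
           {(s, k, i, l, j). s + k + i = n \<and>
              l \<in> {1..cpoly.dim (homogeneous_monogenics {1..p} k)} \<and>
              j \<in> {1..cpoly.dim (homogeneous_monogenics {p+1..m} i)}}
           (\<lambda>(s, k, i, l, j). monogenic_proj {1..m} (vec_var {1..p} ^ s * P k l * Q i j))
           (homogeneous_monogenics {1..m} n)"
proof -
  define I K M where "I = {1..p}" and "K = {p+1..m}" and "M = {1..m}"
  define L where "L = (\<lambda>k. {1..cpoly.dim (homogeneous_monogenics I k)})"
  define N where "N = (\<lambda>i. {1..cpoly.dim (homogeneous_monogenics K i)})"
  define J where "J = {(s, k, i, l, j). s + k + i = n \<and> l \<in> L k \<and> j \<in> N i}"
  define b where "b = (\<lambda>(s, k, i, l, j). monogenic_proj M (vec_var I ^ s * P k l * Q i j))"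
  have fin: "finite I" "finite K" "finite M" and ne: "I \<noteq> {}" "K \<noteq> {}" "M \<noteq> {}"
    and disj: "I \<inter> K = {}" and M: "M = I \<union> K"
    using assms(1-3) by (auto simp: I_def K_def M_def)
  have P: "orthonormal_basis (L k) (P k) (homogeneous_monogenics I k)" for k
    unfolding L_def I_def by (rule assms(4))
  have Q: "orthonormal_basis (N i) (Q i) (homogeneous_monogenics K i)" for i
    unfolding N_def K_def by (rule assms(5))
  have span_P: "cpoly.span (P k ` L k) = homogeneous_monogenics I k" for k
    using P[of k] by (simp add: orthonormal_basis_def orthogonal_basis_def is_basis_def)
  have span_Q: "cpoly.span (Q i ` N i) = homogeneous_monogenics K i" for i
    using Q[of i] by (simp add: orthonormal_basis_def orthogonal_basis_def is_basis_def)
  have P_in: "P k l \<in> homogeneous_monogenics I k" if "l \<in> L k" for k l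
    using that cpoly.span_base[of "P k l" "P k ` L k"] span_P by blast
  have Q_in: "Q i j \<in> homogeneous_monogenics K i" if "j \<in> N i" for i j
    using that cpoly.span_base[of "Q i j" "Q i ` N i"] span_Q by blast
  \<comment> \<open>The given bases settle equal degrees; for different \<open>k\<close> the
    polynomials are orthogonal because they share no monomial.\<close>
  have P_inner: "fischer_inner (P k l) (P k' l') = (if k = k' \<and> l = l' then 1 else 0)"
    if "l \<in> L k" "l' \<in> L k'" for k k' l l'
  proof (cases "k = k'")
    case True
    then show ?thesis
      using P[of k] that by (auto simp: orthonormal_basis_def orthogonal_basis_def)
  next
    case False
    then show ?thesis
      using fischer_inner_hpolys_degree[of "P k l" I k "P k' l'" I k'] P_in[OF that(1)] P_in[OF that(2)]
      by (simp add: homogeneous_monogenics_iff)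
  qed
  have Q_inner: "fischer_inner (Q i j) (Q i' j') = (if i = i' \<and> j = j' then 1 else 0)"
    if "j \<in> N i" "j' \<in> N i'" for i i' j j'
  proof (cases "i = i'")
    case True
    then show ?thesis
      using Q[of i] that by (auto simp: orthonormal_basis_def orthogonal_basis_def)
  next
    case False
    then show ?thesis
      using fischer_inner_hpolys_degree[of "Q i j" K i "Q i' j'" K i'] Q_in[OF that(1)] Q_in[OF that(2)]
      by (simp add: homogeneous_monogenics_iff)
  qed
  have F_in: "vec_var I ^ s * P k l * Q i j \<in> hpolys M n" if "(s, k, i, l, j) \<in> J" for s k i l j
    using that monogenic_products_in_hpolys[OF P_in Q_in] by (auto simp: J_def M)
  have b_eq: "b (s, k, i, l, j) = fischer_proj M n (vec_var I ^ s * P k l * Q i j)"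
    if "(s, k, i, l, j) \<in> J" for s k i l j
    using monogenic_proj_eq[OF fin(3) ne(3) F_in[OF that]] by (simp add: b_def)
  have b_in: "b x \<in> homogeneous_monogenics M n" if "x \<in> J" for x
    using that fischer_proj_in_homogeneous_monogenics[OF fin(3) ne(3) F_in]
    by (cases x) (simp add: b_eq)
  have "orthogonal_basis J b (homogeneous_monogenics M n)"
  proof (rule orthogonal_basisI)
    fix x y assume J: "x \<in> J" "y \<in> J" and "x \<noteq> y"
    obtain s k i l j t k' i' l' j' where xy: "x = (s, k, i, l, j)" "y = (t, k', i', l', j')"
      by (cases x, cases y) blast
    have mem: "l \<in> L k" "l' \<in> L k'" "j \<in> N i" "j' \<in> N i'" "s + k + i = n" "t + k' + i' = n"
      using J by (auto simp: J_def xy)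
    have "s \<noteq> t \<or> fischer_inner (P k l) (P k' l') = 0 \<or> fischer_inner (Q i j) (Q i' j') = 0"
      using \<open>x \<noteq> y\<close> mem P_inner Q_inner by (auto simp: xy)
    then show "fischer_inner (b x) (b y) = 0"
      using J fischer_inner_proj_monogenic_products[OF fin(1,2) ne(1,2) disj P_in[OF mem(1)]
          P_in[OF mem(2)] Q_in[OF mem(3)] Q_in[OF mem(4)] mem(5,6)]
      by (simp add: xy b_eq M)
  next
    fix x assume J: "x \<in> J"
    obtain s k i l j where x: "x = (s, k, i, l, j)"
      by (cases x) blast
    have mem: "l \<in> L k" "j \<in> N i"
      using J by (auto simp: J_def x)
    let ?F = "vec_var I ^ s * P k l * Q i j"
    show "b x \<noteq> 0"
    \<comment> \<open>A vanishing projection would make the product a multiple of \<open>x\<close>,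
      hence 0, whereas its norm is nonzero by the orthonormality of the two bases.\<close>
    proof
      assume "b x = 0"
      obtain H where "?F = fischer_proj M n ?F + vec_var M * H"
        by (rule fischer_step[OF F_in]) (use J x in auto)
      then have "?F = vec_var (I \<union> K) * H"
        using \<open>b x = 0\<close> J by (simp add: x b_eq M)
      moreover have "vec_var I ^ s * P k l \<in> hpolys I (s + k)"
        using P_in[OF mem(1)] by (intro hpolys_vec_var_power_mult) (auto simp: homogeneous_monogenics_iff)
      ultimately have "?F = 0"
        using vec_var_mult_product_eq_0[OF fin(1,2) ne(2) disj] Q_in[OF mem(2)] by blast
      moreover have "fischer_inner ?F ?F \<noteq> 0"
        using fischer_inner_monogenic_products[OF fin(1) ne(1) disj P_in P_in Q_in Q_in] mem
          P_inner Q_inner by simp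
      ultimately show False
        by simp
    qed
  next
    let ?W = "cpoly.span (b ` J)" and ?X = "range (\<lambda>H. vec_var M * H)"
    \<comment> \<open>The span is enlarged by all multiples of \<open>x\<close>, since a product
      agrees with its projection only modulo these.\<close>
    let ?T = "{g + h |g h. g \<in> ?W \<and> h \<in> ?X}"
    have W: "?W \<subseteq> homogeneous_monogenics M n"
      using b_in by (intro cpoly.span_minimal subspace_homogeneous_monogenics) blast
    have "cpoly.subspace ?X"
      unfolding cpoly.subspace_def
      by (auto simp: distrib_left[symmetric] poly_scale_mult_right[symmetric]
          intro: range_eqI[of _ _ 0])
    then have T: "cpoly.subspace ?T"
      by (rule cpoly.subspace_sums[OF cpoly.subspace_span])
    have ideal: "vec_var (I \<union> K) * H \<in> ?T" for H
      using cpoly.span_zero[of "b ` J"] unfolding M[symmetric] by force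
    have basis: "vec_var I ^ s * P k l * Q i j \<in> ?T" if J: "(s, k, i, l, j) \<in> J" for s k i l j
    proof -
      obtain H where "vec_var I ^ s * P k l * Q i j = b (s, k, i, l, j) + vec_var M * H"
        using fischer_step[OF F_in[OF J]] b_eq[OF J] by metis
      moreover have "b (s, k, i, l, j) \<in> ?W"
        using J by (intro cpoly.span_base imageI)
      ultimately show ?thesis
        by blast
    qed
    \<comment> \<open>The product is linear in \<open>F\<close> and in \<open>G\<close>. Membership
      extends from the basis products first to all \<open>F\<close> with \<open>Q i j\<close> fixed,
      then to all \<open>G\<close> with \<open>F\<close> fixed.\<close>
    have gens: "vec_var I ^ s * F * G \<in> ?T"
      if "s + k + i = n" "F \<in> homogeneous_monogenics I k" "G \<in> homogeneous_monogenics K i" for s k i F G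
    proof -
      have "cpoly.subspace {F. vec_var I ^ s * F * G \<in> ?T}" for G
        using T unfolding cpoly.subspace_def
        by (simp add: distrib_left distrib_right poly_scale_mult_left poly_scale_mult_right)
      moreover have "cpoly.subspace {G. vec_var I ^ s * F * G \<in> ?T}" for F
        using T unfolding cpoly.subspace_def
        by (simp add: distrib_left distrib_right poly_scale_mult_left poly_scale_mult_right)
      moreover have "P k l \<in> {F. vec_var I ^ s * F * Q i j \<in> ?T}" if "l \<in> L k" "j \<in> N i" for l j
        using basis that \<open>s + k + i = n\<close> by (simp add: J_def)
      ultimately have "F \<in> {F. vec_var I ^ s * F * Q i j \<in> ?T}" if "j \<in> N i" for j
        using that \<open>F \<in> homogeneous_monogenics I k\<close>
          cpoly.span_minimal[of "P k ` L k" "{F. vec_var I ^ s * F * Q i j \<in> ?T}"]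
        unfolding span_P by blast
      then have "Q i ` N i \<subseteq> {G. vec_var I ^ s * F * G \<in> ?T}"
        by blast
      then show ?thesis
        using cpoly.span_minimal[of "Q i ` N i" "{G. vec_var I ^ s * F * G \<in> ?T}"]
          \<open>\<And>F. cpoly.subspace {G. vec_var I ^ s * F * G \<in> ?T}\<close> that(3)
        unfolding span_Q by blast
    qed
    have "hpolys M n \<subseteq> ?T"
      unfolding M by (rule hpolys_subset_monogenic_products[OF fin(1,2) ne(1,2) disj T[unfolded M]])
        (use ideal gens in \<open>simp_all only: M\<close>)
    then have "homogeneous_monogenics M n \<subseteq> ?W"
    proof (intro subsetI)
      fix f assume sub: "hpolys M n \<subseteq> ?T" and f: "f \<in> homogeneous_monogenics M n"
      then obtain g H where g: "f = g + vec_var M * H" "g \<in> ?W"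
        using sub unfolding homogeneous_monogenics_iff by blast
      \<comment> \<open>Both \<open>f\<close> and \<open>g\<close> are monogenic and differ by a
        multiple of \<open>x\<close>; the zero witness writes \<open>f\<close> as
        \<open>f + x 0\<close>.\<close>
      then have "f = g"
        using monogenic_part_unique[of f M 0 g H] f W homogeneous_monogenics_subset by auto
      then show "f \<in> ?W"
        using g by simp
    qed
    then show "?W = homogeneous_monogenics M n"
      using W by blast
  qed
  then show ?thesis
    unfolding b_def J_def L_def N_def I_def K_def M_def .
qed

end
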